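(* Let $p$ be a probability distribution on $\mathbb{R}$ with mean $0$, variance $1$ and finite higher moments, and consider the ensemble of $N\times N$ real symmetric palindromic Toeplitz matrices whose independent entries are chosen independently from $p$. For each integer $m\ge 0$, the limit $M_m=\lim_{N\to\infty}M_m(N)$ of the average $m$-th moments of the normalized empirical spectral measures exists and equals the $m$-th moment of the standard Gaussian density. Specifically, $M_{2k+1}=0$ and $M_{2k}=(2k-1)!!$, where $(2k-1)!!=(2k-1)(2k-3)\cdots 3\cdot 1$.
   Context: Throughout $N$ is even. The $N\times N$ real symmetric palindromic Toeplitz matrix $A_N$ with parameters $b_0,\dots,b_{N/2-1}$ has entries $a_{ij}=b_{\min(|i-j|,\,N-1-|i-j|)}$, $1\le i,j\le N$; its first row is the palindrome $(b_0,b_1,\dots,b_{N/2-1},b_{N/2-1},\dots,b_1,b_0)$. The $b_0,\dots,b_{N/2-1}$ are independent random variables with distribution $p$, and $\mathbb{E}$ denotes expectation. If $\lambda_1,\dots,\lambda_N$ are the eigenvalues of $A_N$, the $m$-th moment of the normalized spectral measure (mass $1/N$ at each $\lambda_i/\sqrt{N}$) is $M_m(A_N)=\frac{1}{N^{m/2+1}}\sum_{i=1}^N\lambda_i^m$. The average $m$-th moment is $M_m(N)=\mathbb{E}[M_m(A_N)]=\frac{1}{N^{m/2+1}}\sum_{1\le i_1,\dots,i_m\le N}\mathbb{E}(a_{i_1i_2}a_{i_2i_3}\cdots a_{i_mi_1})$, and $M_m=\lim_{N\to\infty}M_m(N)$. By convention $(-1)!!=1$. "Finite higher moments" means all moments of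 $p$ are finite. *)

theory Defs
  imports "HOL-Probability.Probability" "Jordan_Normal_Form.Char_Poly"
begin

definition palindromic_toeplitz :: "nat \<Rightarrow> (nat \<Rightarrow> real) \<Rightarrow> real mat" where
  "palindromic_toeplitz N b =
     Matrix.mat N N (\<lambda>(i, j). let d = nat \<bar>int i - int j\<bar> in b (min d (N - 1 - d)))"

text \<open>
  The eigenvalues are the real roots of the characteristic polynomial, counted with multiplicity.
  A real symmetric \<open>N \<times> N\<close> matrix has exactly \<open>N\<close> of them (proved below), so for \<open>N > 0\<close>
  normalising by their number gives each of them mass \<open>1 / N\<close>.
\<close>
definition normalized_spectral_measure :: "real mat \<Rightarrow> real pmf" where
  "normalized_spectral_measure A =
     pmf_of_multiset (image_mset (\<lambda>x. x / sqrt (real (dim_row A))) (proots (char_poly A)))"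

definition spectral_moment :: "nat \<Rightarrow> real mat \<Rightarrow> real" where
  "spectral_moment m A = measure_pmf.expectation (normalized_spectral_measure A) (\<lambda>x. x ^ m)"

definition average_moment :: "nat \<Rightarrow> nat \<Rightarrow> 'w measure \<Rightarrow> (nat \<Rightarrow> 'w \<Rightarrow> real) \<Rightarrow> real" where
  "average_moment m N \<Omega> b = prob_space.expectation \<Omega>
     (\<lambda>\<omega>. spectral_moment m (palindromic_toeplitz N (\<lambda>i. b i \<omega>)))"

lemma palindromic_toeplitz_carrier: "palindromic_toeplitz N b \<in> carrier_mat N N"
  by (simp add: palindromic_toeplitz_def)

lemma palindromic_toeplitz_symmetric:
  "transpose_mat (palindromic_toeplitz N b) = palindromic_toeplitz N b"
  by (intro eq_matI) (auto simp: palindromic_toeplitz_def abs_minus_commute)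

lemma real_symmetric_eigenvalue_real:
  fixes A :: "real mat"
  assumes A: "A \<in> carrier_mat n n" and sym: "transpose_mat A = A"
    and ev: "eigenvalue (map_mat complex_of_real A) z"
  shows "z \<in> \<real>"
proof -
  let ?B = "map_mat complex_of_real A"
  have B: "?B \<in> carrier_mat n n" using A by simp
  have BT: "transpose_mat ?B = ?B"
    using sym map_mat_transpose[of complex_of_real A] by simp
  from ev B obtain v where v: "v \<in> carrier_vec n" "v \<noteq> 0\<^sub>v n" and Bv: "?B *\<^sub>v v = z \<cdot>\<^sub>v v"
    unfolding eigenvalue_def eigenvector_def by auto
  have conjB: "?B *\<^sub>v conjugate v = conjugate (?B *\<^sub>v v)"
    using A v(1) by (intro eq_vecI) (auto simp: scalar_prod_def)
  have cv: "conjugate v \<in> carrier_vec n" using v(1) by simp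
  have "z * (v \<bullet> conjugate v) = (?B *\<^sub>v v) \<bullet> conjugate v"
    using v(1) by (simp add: Bv)
  also have "\<dots> = v \<bullet> (?B *\<^sub>v conjugate v)"
    using transpose_vec_mult_scalar[OF B cv v(1)] BT by simp
  also have "\<dots> = conjugate z * (v \<bullet> conjugate v)"
    using v(1) by (simp add: conjB Bv conjugate_smult_vec)
  finally have "z = conjugate z"
    using v conjugate_square_eq_0_vec[OF v(1)] by auto
  then show ?thesis by (simp add: Reals_cnj_iff conjugate_complex_def)
qed

lemma size_eigenvalues_real_symmetric:
  fixes A :: "real mat"
  assumes A: "A \<in> carrier_mat n n" and sym: "transpose_mat A = A"
  shows "size (proots (char_poly A)) = n"
proof -
  interpret map_poly_inj_idom_divide_hom complex_of_real ..
  let ?p = "char_poly A" and ?q = "map_poly complex_of_real (char_poly A)"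
  have q: "?q = char_poly (map_mat complex_of_real A)"
    by (rule of_real_hom.char_poly_hom[OF A, symmetric])
  have p0: "?p \<noteq> 0" and deg: "degree ?p = n" using degree_monic_char_poly[OF A] by auto
  then have q0: "?q \<noteq> 0" by simp
  have B: "map_mat complex_of_real A \<in> carrier_mat n n" using A by simp
  have count_inj: "count (image_mset complex_of_real E) (complex_of_real x) = count E x" for E x
    by (induction E) auto
  have "proots ?q = image_mset complex_of_real (proots ?p)"
  proof (rule multiset_eqI)
    fix z
    show "count (proots ?q) z = count (image_mset complex_of_real (proots ?p)) z"
    proof (cases "z \<in> \<real>")
      case True
      then obtain x where z: "z = complex_of_real x" by (auto elim: Reals_cases)
      have "count (image_mset complex_of_real (proots ?p)) z = count (proots ?p) x"
        unfolding z using count_inj[of "proots ?p" x] .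
      then show ?thesis using p0 q0 by (simp add: z order_hom)
    next
      case False
      then have "poly ?q z \<noteq> 0"
        using real_symmetric_eigenvalue_real[OF A sym, of z] eigenvalue_root_char_poly[OF B] q by auto
      then have "z \<notin># proots ?q" using q0 by simp
      moreover have "z \<notin># image_mset complex_of_real (proots ?p)" using False by auto
      ultimately show ?thesis by (metis count_inI)
    qed
  qed
  then have "size (proots ?p) = size (proots ?q)" by simp
  then show ?thesis by (simp add: size_proots_complex deg)
qed

lemma spectral_moment_eq:
  fixes A :: "real mat"
  assumes A: "A \<in> carrier_mat N N" and sym: "transpose_mat A = A" and N: "0 < N"
  shows "spectral_moment m A =
    (\<Sum>x\<in>#proots (char_poly A). x ^ m) / real N powr (real m / 2 + 1)"
proof -
  let ?E = "proots (char_poly A)" and ?f = "\<lambda>x. x / sqrt (real N)"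
  have sz: "size ?E = N" by (rule size_eigenvalues_real_symmetric[OF A sym])
  then have ne: "image_mset ?f ?E \<noteq> {#}" using N by auto
  have sum_count: "(\<Sum>y\<in>#X. g y) = (\<Sum>y\<in>S. real (count X y) * g y)"
    if "finite S" "set_mset X \<subseteq> S" for S X and g :: "real \<Rightarrow> real"
    using that
  proof (induction X)
    case (add x X)
    have "(\<Sum>y\<in>S. real (count (add_mset x X) y) * g y)
        = (\<Sum>y\<in>S. real (count X y) * g y + (if y = x then g y else 0))"
      by (intro sum.cong) (auto simp: algebra_simps)
    then show ?case using add by (simp add: sum.distrib)
  qed simp
  have sum_div: "(\<Sum>x\<in>#X. g x / c) = (\<Sum>x\<in>#X. g x) / c" for X c and g :: "real \<Rightarrow> real"
    by (induction X) (simp_all add: add_divide_distrib)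
  have "spectral_moment m A = (\<Sum>y\<in>set_mset (image_mset ?f ?E).
      y ^ m * (real (count (image_mset ?f ?E) y) / real N))"
    using A ne sz unfolding spectral_moment_def normalized_spectral_measure_def
    by (subst integral_measure_pmf[where A = "set_mset (image_mset ?f ?E)"])
      (auto simp: set_pmf_of_multiset mult.commute)
  also have "\<dots> = (\<Sum>y\<in>#image_mset ?f ?E. y ^ m) / real N"
    by (subst sum_count[of "set_mset (image_mset ?f ?E)"]) (simp_all add: sum_divide_distrib mult.commute)
  also have "(\<Sum>y\<in>#image_mset ?f ?E. y ^ m) = (\<Sum>x\<in>#?E. x ^ m) / sqrt (real N) ^ m"
    by (simp add: power_divide multiset.map_comp comp_def sum_div)
  also have "sqrt (real N) ^ m = real N powr (real m / 2)"
    using N by (simp add: powr_half_sqrt[symmetric] powr_realpow[symmetric] powr_powr)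
  finally show ?thesis using N by (simp add: powr_add)
qed

end

(*
  Deleting the last row and column of the 2n x 2n palindromic Toeplitz matrix leaves a symmetric
  circulant matrix of odd size M = 2n - 1, whose eigenvalues lam_0, ..., lam_{M-1} are explicit
  linear combinations of the independent entries: the coefficients are bounded by 2 and, for k > 0,
  the sum of their squares is exactly M - 1. Since the deleted row repeats the first one, the trace
  of the m-th power of the matrix differs from (2n / M) * sum_k lam_k^m by at most
  2^m * max_k |lam_k|^m, which is negligible in expectation.
  It remains to find the moments of a weighted sum S of independent centred variables. Expanding
  E[S^(m+2)] = sum_i E[X_i S^(m+1)] in powers of X_i gives
  E[S^(m+2)] = (m+1) Var(S) E[S^m] + (lower order), uniformly in the weights, and this is the
  recursion of the Gaussian moments.
*)

theory Submission
  imports Defs "Jordan_Normal_Form.Schur_Decomposition" "HOL-Real_Asymp.Real_Asymp"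
begin

section \<open>Traces of powers\<close>

text \<open>Different eigenvalues of the circulant are dependent, but only the expectations of the
  single powers lam_k^m enter. So one estimate for a weighted sum, uniform in the weights, serves
  every k, and no pairings of indices have to be counted. The size M = 2n - 1 is odd because N is
  even; hence M divides 2k with k < M only for k = 0, which is what gives all other eigenvalues the
  same variance. The eigenvalue with k = 0 has variance 2M - 1, about twice as large, but it carries
  only the weight 1/M in the average. The bound for the maximum must be better than the sum of all
  |lam_k|^m: that sum has order N^(m/2+1), the order of the normalisation itself. The square root of
  the sum of lam_k^(2m) has order N^((m+1)/2) and saves a factor sqrt N. All constants depend only
  on m and on the moments of p, so every N may have its own probability space.\<close>

lemma poly_split_of_size_proots:
  fixes p :: "'a :: field poly"
  assumes "p \<noteq> 0" "size (proots p) = degree p"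
  shows "Polynomial.smult (lead_coeff p) (\<Prod>x\<in>#proots p. [:- x, 1:]) = p"
  using assms
proof (induction "degree p" arbitrary: p)
  case 0
  then obtain c where "p = [:c:]" by (metis degree_eq_zeroE)
  then show ?case by simp
next
  case (Suc n)
  then have "proots p \<noteq> {#}" by auto
  then obtain a where "a \<in># proots p" by (meson multiset_nonemptyE)
  then have "poly p a = 0" using Suc.prems by simp
  then obtain q where q: "p = [:- a, 1:] * q" using poly_eq_0_iff_dvd by blast
  with Suc.prems have q0: "q \<noteq> 0" by auto
  have pr: "proots p = add_mset a (proots q)"
    unfolding q using q0 by (subst proots_mult) auto
  have deg: "degree p = Suc (degree q)"
    unfolding q using q0 by (subst degree_mult_eq) auto
  have "Polynomial.smult (lead_coeff q) (\<Prod>x\<in>#proots q. [:- x, 1:]) = q"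
    using Suc.hyps(2) Suc.prems(2) deg pr q0 by (intro Suc.hyps(1)) auto
  moreover have "lead_coeff p = lead_coeff q"
    unfolding q lead_coeff_mult by simp
  moreover have "Polynomial.smult (lead_coeff p) (\<Prod>x\<in>#proots p. [:- x, 1:])
      = [:- a, 1:] * Polynomial.smult (lead_coeff p) (\<Prod>x\<in>#proots q. [:- x, 1:])"
    unfolding pr by (simp only: image_mset_add_mset prod_mset.add_mset mult_smult_right)
  ultimately show ?case using q by metis
qed

definition mat_trace :: "'a :: comm_monoid_add mat \<Rightarrow> 'a" where
  "mat_trace A = (\<Sum>i<dim_row A. A $$ (i, i))"

lemma mat_trace_commute:
  fixes A B :: "'a :: comm_semiring_0 mat"
  assumes "A \<in> carrier_mat n k" "B \<in> carrier_mat k n"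
  shows "mat_trace (A * B) = mat_trace (B * A)"
proof -
  have "mat_trace (A * B) = (\<Sum>i<n. \<Sum>j<k. A $$ (i, j) * B $$ (j, i))"
    using assms by (auto simp: mat_trace_def scalar_prod_def lessThan_atLeast0 intro!: sum.cong)
  also have "\<dots> = (\<Sum>j<k. \<Sum>i<n. B $$ (j, i) * A $$ (i, j))"
    by (subst sum.swap) (simp add: mult.commute)
  also have "\<dots> = mat_trace (B * A)"
    using assms by (auto simp: mat_trace_def scalar_prod_def lessThan_atLeast0 intro!: sum.cong)
  finally show ?thesis .
qed

lemma mat_trace_similar:
  fixes A B :: "'a :: comm_semiring_1 mat"
  assumes "similar_mat_wit A B P Q"
  shows "mat_trace A = mat_trace B"
proof -
  define n where "n = dim_row A"
  note D = similar_mat_witD[OF n_def assms]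
  have "mat_trace A = mat_trace (Q * (P * B))"
    using D mat_trace_commute[of "P * B" n n Q] by simp
  also have "Q * (P * B) = B"
    using D assoc_mult_mat[of Q n n P n B n] by (simp del: assoc_mult_mat)
  finally show ?thesis .
qed

lemma upper_triangular_pow:
  fixes B :: "'a :: comm_semiring_1 mat"
  assumes B: "B \<in> carrier_mat n n" and ut: "upper_triangular B"
  shows "upper_triangular (B ^\<^sub>m k) \<and> (\<forall>i<n. (B ^\<^sub>m k) $$ (i, i) = (B $$ (i, i)) ^ k)"
proof (induction k)
  case 0
  then show ?case using B by auto
next
  case (Suc k)
  have C: "B ^\<^sub>m k \<in> carrier_mat n n" using B by (rule pow_carrier_mat)
  have entry: "(B ^\<^sub>m Suc k) $$ (i, j) = (\<Sum>l\<in>{i..j}. (B ^\<^sub>m k) $$ (i, l) * B $$ (l, j))"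
    if "i < n" "j < n" for i j
  proof -
    have "(B ^\<^sub>m Suc k) $$ (i, j) = (\<Sum>l<n. (B ^\<^sub>m k) $$ (i, l) * B $$ (l, j))"
      using that B C by (auto simp: scalar_prod_def lessThan_atLeast0 intro!: sum.cong)
    also have "\<dots> = (\<Sum>l\<in>{i..j}. (B ^\<^sub>m k) $$ (i, l) * B $$ (l, j))"
    proof (rule sum.mono_neutral_right)
      show "\<forall>l\<in>{..<n} - {i..j}. (B ^\<^sub>m k) $$ (i, l) * B $$ (l, j) = 0"
      proof
        fix l assume l: "l \<in> {..<n} - {i..j}"
        then consider "l < i" | "j < l" by fastforce
        then show "(B ^\<^sub>m k) $$ (i, l) * B $$ (l, j) = 0"
        proof cases
          case 1
          then show ?thesis using Suc C that by (metis carrier_matD(1) mult_zero_left upper_triangularD)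
        next
          case 2
          then show ?thesis using ut B l by (simp add: upper_triangularD)
        qed
      qed
    qed (use that in auto)
    finally show ?thesis .
  qed
  show ?case
    using Suc B C by (auto intro!: upper_triangularI simp: entry simp del: pow_mat.simps)
      (auto simp: mult.commute)
qed

text \<open>Symmetry makes the characteristic polynomial split over the reals, so a real Schur form
  exists. Its diagonal is the multiset of eigenvalues, and powers of a triangular matrix have the
  powers of these entries on the diagonal.\<close>

lemma sum_proots_power_eq_trace:
  fixes A :: "real mat"
  assumes A: "A \<in> carrier_mat n n" and sym: "transpose_mat A = A"
  shows "(\<Sum>x\<in>#proots (char_poly A). x ^ m) = mat_trace (A ^\<^sub>m m)"
proof -
  let ?E = "proots (char_poly A)"
  note mon = degree_monic_char_poly[OF A]
  have p0: "char_poly A \<noteq> 0" using mon by auto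
  obtain es where es: "mset es = ?E" using ex_mset by blast
  have split: "char_poly A = (\<Prod>x\<in>#?E. [:- x, 1:])"
    using poly_split_of_size_proots[OF p0] size_eigenvalues_real_symmetric[OF A sym] mon by simp
  then have lin: "char_poly A = (\<Prod>a\<leftarrow>es. [:- a, 1:])"
    unfolding es[symmetric] by (simp flip: prod_mset_prod_list)
  obtain B where B: "B \<in> carrier_mat n n" "upper_triangular B" "similar_mat A B"
    using schur_decomposition_exists[OF A lin] by blast
  obtain P Q where PQ: "similar_mat_wit A B P Q" using B(3) unfolding similar_mat_def by blast
  have "char_poly A = (\<Prod>a\<leftarrow>diag_mat B. [:- a, 1:])"
    using char_poly_similar[OF B(3)] char_poly_upper_triangular[OF B(1,2)] by simp
  then have "?E = proots (\<Prod>a\<leftarrow>diag_mat B. [:- a, 1:])" by simp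
  also have "\<dots> = mset (diag_mat B)"
  proof -
    have "proots (\<Prod>a\<leftarrow>xs. [:- a, 1:]) = mset xs" for xs :: "real list"
    proof (induction xs)
      case (Cons a xs)
      have "(\<Prod>a\<leftarrow>xs. [:- a, 1:]) \<noteq> 0" by (auto simp: prod_list_zero_iff)
      then have "proots ([:- a, 1:] * (\<Prod>a\<leftarrow>xs. [:- a, 1:])) = {#a#} + mset xs"
        using Cons by (subst proots_mult) auto
      then show ?case by (simp del: mult_pCons_left)
    qed simp
    then show ?thesis .
  qed
  finally have E: "?E = mset (diag_mat B)" .
  have "(\<Sum>x\<in>#?E. x ^ m) = (\<Sum>x\<leftarrow>diag_mat B. x ^ m)"
    unfolding E by (metis mset_map sum_mset_sum_list)
  also have "\<dots> = (\<Sum>i<n. (B $$ (i, i)) ^ m)"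
    using B(1) by (simp add: diag_mat_def comp_def interv_sum_list_conv_sum_set_nat lessThan_atLeast0)
  also have "\<dots> = mat_trace (B ^\<^sub>m m)"
    using upper_triangular_pow[OF B(1,2), of m] B(1) by (simp add: mat_trace_def)
  also have "\<dots> = mat_trace (A ^\<^sub>m m)"
    using mat_trace_similar[OF similar_mat_wit_pow[OF PQ]] by simp
  finally show ?thesis .
qed

section \<open>Moments of sums of independent variables\<close>

text \<open>The constant produced by the induction in \<open>E_bound\<close>: a term with
  \<open>l + 2\<close> factors \<open>X i\<close> costs \<open>A (l + 2)\<close> and leaves a moment
  of lower order. It depends neither on the index set nor on the scale \<open>R\<close>.\<close>

fun moment_bound :: "(nat \<Rightarrow> real) \<Rightarrow> nat \<Rightarrow> real" where
  "moment_bound A 0 = 1"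
| "moment_bound A (Suc m) =
    (\<Sum>l<m. real (m choose Suc l) * A (l + 2) * moment_bound A (m - Suc l))"

text \<open>The first sum collects the terms with at least three factors \<open>X i\<close>; the
  second is the cost of putting \<open>X i\<close> back into the sum after the quadratic term has
  been taken out.\<close>

definition recursion_bound :: "(nat \<Rightarrow> real) \<Rightarrow> nat \<Rightarrow> real" where
  "recursion_bound A m =
    (\<Sum>l<m. real (Suc m choose (l + 2)) * A (l + 3) * moment_bound A (m - Suc l)) +
    real (Suc m) * A 2 * (\<Sum>l<m. real (m choose Suc l) * A (Suc l) * moment_bound A (m - Suc l))"

lemma sum_atMost_Suc_shift2:
  fixes f :: "nat \<Rightarrow> 'a :: comm_monoid_add"
  shows "(\<Sum>l\<le>Suc m. f l) = f 0 + (f 1 + (\<Sum>l<m. f (l + 2)))"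
  by (subst sum.atMost_shift, subst sum.lessThan_Suc_shift) simp

lemma moment_bound_nonneg:
  assumes "\<And>k. 0 \<le> A k"
  shows "0 \<le> moment_bound A m"
proof (induction m rule: less_induct)
  case (less m)
  then show ?case
    using assms by (cases m) (auto intro!: sum_nonneg mult_nonneg_nonneg)
qed

lemma recursion_bound_nonneg:
  assumes "\<And>k. 0 \<le> A k"
  shows "0 \<le> recursion_bound A m"
  unfolding recursion_bound_def
  using assms moment_bound_nonneg[OF assms] by (intro add_nonneg_nonneg mult_nonneg_nonneg sum_nonneg) auto

text \<open>The variables will be matrix entries multiplied by different weights, hence not
  identically distributed. The common bounds \<open>A k\<close> take the place of a common law and
  make every estimate uniform.\<close>

locale centred_indep = prob_space M for M :: "'a measure" +
  fixes X :: "'i \<Rightarrow> 'a \<Rightarrow> real" and I :: "'i set" and A :: "nat \<Rightarrow> real"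
  assumes finite_I: "finite I"
    and indep: "indep_vars (\<lambda>_. borel) X I"
    and int: "\<And>i k. i \<in> I \<Longrightarrow> integrable M (\<lambda>\<omega>. X i \<omega> ^ k)"
    and mean: "\<And>i. i \<in> I \<Longrightarrow> expectation (X i) = 0"
    and moments: "\<And>i k. i \<in> I \<Longrightarrow> \<bar>expectation (\<lambda>\<omega>. X i \<omega> ^ k)\<bar> \<le> A k"
    and A_nonneg: "\<And>k. 0 \<le> A k"
begin

abbreviation S :: "'i set \<Rightarrow> 'a \<Rightarrow> real" where
  "S J \<omega> \<equiv> \<Sum>i\<in>J. X i \<omega>"

abbreviation E :: "'i set \<Rightarrow> nat \<Rightarrow> real" where
  "E J m \<equiv> expectation (\<lambda>\<omega>. S J \<omega> ^ m)"

lemma indep_powers: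
  assumes "J \<subseteq> I" "i \<in> I" "i \<notin> J"
  shows "indep_var borel (\<lambda>\<omega>. X i \<omega> ^ k) borel (\<lambda>\<omega>. S J \<omega> ^ l)"
proof -
  have "finite J" using assms finite_I finite_subset by blast
  then have "indep_var borel (X i) borel (S J)"
    using assms by (intro indep_vars_sum indep_vars_subset[OF indep]) auto
  from indep_var_compose[OF this, of "\<lambda>x. x ^ k" borel "\<lambda>x. x ^ l" borel]
  show ?thesis by (simp add: comp_def)
qed

lemma S_insert_power:
  assumes "J \<subseteq> I" "i \<notin> J"
  shows "X i \<omega> ^ a * S (insert i J) \<omega> ^ m =
    (\<Sum>l\<le>m. real (m choose l) * (X i \<omega> ^ (a + l) * S J \<omega> ^ (m - l)))"
proof -
  have "finite J" using assms finite_I finite_subset by blast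
  then have "S (insert i J) \<omega> = X i \<omega> + S J \<omega>" using assms by simp
  then show ?thesis
    by (simp add: binomial_ring sum_distrib_left power_add mult_ac)
qed

lemma integrable_S_power:
  assumes "J \<subseteq> I"
  shows "integrable M (\<lambda>\<omega>. S J \<omega> ^ m)"
proof -
  have "finite J" using assms finite_I finite_subset by blast
  then show ?thesis using assms
  proof (induction J arbitrary: m)
    case (insert i J)
    have eq: "(\<lambda>\<omega>. S (insert i J) \<omega> ^ m) =
      (\<lambda>\<omega>. \<Sum>l\<le>m. real (m choose l) * (X i \<omega> ^ l * S J \<omega> ^ (m - l)))"
      using S_insert_power[of J i _ 0 m] insert by auto
    show ?case unfolding eq
      using insert int
      by (intro Bochner_Integration.integrable_sum integrable_mult_right
          indep_var_integrable indep_powers) auto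
  qed simp
qed

lemma
  assumes "J \<subseteq> I" "i \<in> I" "i \<notin> J"
  shows integrable_insert: "integrable M (\<lambda>\<omega>. X i \<omega> ^ a * S (insert i J) \<omega> ^ m)" (is ?int)
    and expectation_insert: "expectation (\<lambda>\<omega>. X i \<omega> ^ a * S (insert i J) \<omega> ^ m) =
      (\<Sum>l\<le>m. real (m choose l) * (expectation (\<lambda>\<omega>. X i \<omega> ^ (a + l)) * E J (m - l)))" (is ?ex)
proof -
  have 1: "integrable M (\<lambda>\<omega>. X i \<omega> ^ k * S J \<omega> ^ l)" for k l
    using assms int integrable_S_power by (intro indep_var_integrable indep_powers) auto
  have 2: "expectation (\<lambda>\<omega>. X i \<omega> ^ k * S J \<omega> ^ l) = expectation (\<lambda>\<omega>. X i \<omega> ^ k) * E J l" for k l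
    using assms int integrable_S_power by (intro indep_var_lebesgue_integral indep_powers) auto
  show ?int unfolding S_insert_power[OF assms(1,3)] using 1 by auto
  show ?ex unfolding S_insert_power[OF assms(1,3)]
    using 1 2 by (subst Bochner_Integration.integral_sum) auto
qed

text \<open>Splitting off one factor of the power distinguishes an index \<open>i\<close>. The
  remaining factors are expanded around \<open>X i\<close>, which is independent of the sum over
  \<open>J - {i}\<close>, so each expectation factorises.\<close>

lemma E_Suc:
  assumes "J \<subseteq> I"
  shows "E J (Suc m) = (\<Sum>i\<in>J. \<Sum>l\<le>m. real (m choose l) *
    (expectation (\<lambda>\<omega>. X i \<omega> ^ Suc l) * E (J - {i}) (m - l)))"
proof -
  have ins: "insert i (J - {i}) = J" if "i \<in> J" for i using that by auto
  have "E J (Suc m) = expectation (\<lambda>\<omega>. \<Sum>i\<in>J. X i \<omega> ^ 1 * S J \<omega> ^ m)"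
    by (simp add: sum_distrib_right)
  also have "\<dots> = (\<Sum>i\<in>J. expectation (\<lambda>\<omega>. X i \<omega> ^ 1 * S J \<omega> ^ m))"
  proof (rule Bochner_Integration.integral_sum)
    fix i assume "i \<in> J"
    then show "integrable M (\<lambda>\<omega>. X i \<omega> ^ 1 * S J \<omega> ^ m)"
      using integrable_insert[of "J - {i}" i 1 m] ins[of i] assms by auto
  qed
  also have "\<dots> = (\<Sum>i\<in>J. \<Sum>l\<le>m. real (m choose l) *
    (expectation (\<lambda>\<omega>. X i \<omega> ^ Suc l) * E (J - {i}) (m - l)))"
  proof (rule sum.cong)
    fix i assume "i \<in> J"
    then show "expectation (\<lambda>\<omega>. X i \<omega> ^ 1 * S J \<omega> ^ m) = (\<Sum>l\<le>m. real (m choose l) *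
      (expectation (\<lambda>\<omega>. X i \<omega> ^ Suc l) * E (J - {i}) (m - l)))"
      using expectation_insert[of "J - {i}" i 1 m] ins[of i] assms by auto
  qed simp
  finally show ?thesis .
qed

lemma mean1: "i \<in> I \<Longrightarrow> expectation (\<lambda>\<omega>. X i \<omega> ^ Suc 0) = 0"
  using mean by simp

lemma term_bound:
  assumes J: "J \<subseteq> I" "i \<in> I" and R: "1 \<le> R"
    and bound: "\<bar>E J (m - Suc l)\<bar> \<le> moment_bound A (m - Suc l) * R ^ (m - Suc l)" and "l < m"
  shows "\<bar>real c * (expectation (\<lambda>\<omega>. X i \<omega> ^ k) * E J (m - Suc l))\<bar>
    \<le> real c * A k * moment_bound A (m - Suc l) * R ^ (m - 1)"
proof -
  have "\<bar>E J (m - Suc l)\<bar> \<le> moment_bound A (m - Suc l) * R ^ (m - 1)"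
    using R moment_bound_nonneg[of A] A_nonneg
    by (intro order.trans[OF bound] mult_left_mono power_increasing) auto
  then have "\<bar>expectation (\<lambda>\<omega>. X i \<omega> ^ k)\<bar> * \<bar>E J (m - Suc l)\<bar>
      \<le> A k * (moment_bound A (m - Suc l) * R ^ (m - 1))"
    using moments[OF J(2)] A_nonneg by (intro mult_mono) auto
  then show ?thesis by (simp add: abs_mult mult.assoc mult_left_mono)
qed

text \<open>
  In \<open>E[S\<^sup>m\<^sup>+\<^sup>1] = \<Sum>\<^sub>i E[X\<^sub>i (X\<^sub>i + (S - X\<^sub>i))\<^sup>m]\<close> the term that is linear in \<open>X\<^sub>i\<close> vanishes, so each of the at most \<open>R\<^sup>2\<close>
  summands costs two powers of \<open>S\<close>: this is why \<open>E[S\<^sup>m]\<close> grows like \<open>R\<^sup>m\<close> only.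
\<close>
lemma E_bound:
  assumes "J \<subseteq> I" "real (card J) \<le> R\<^sup>2" "1 \<le> R"
  shows "\<bar>E J m\<bar> \<le> moment_bound A m * R ^ m"
  using assms
proof (induction m arbitrary: J rule: less_induct)
  case (less m)
  show ?case
  proof (cases m)
    case 0
    then show ?thesis by (simp add: prob_space)
  next
    case (Suc k)
    let ?t = "\<lambda>l. real (k choose Suc l) * A (l + 2) * moment_bound A (k - Suc l)"
    have eq: "E J m = (\<Sum>i\<in>J. \<Sum>l<k. real (k choose Suc l) *
      (expectation (\<lambda>\<omega>. X i \<omega> ^ (l + 2)) * E (J - {i}) (k - Suc l)))"
      unfolding Suc E_Suc[OF less.prems(1)]
    proof (rule sum.cong[OF refl])
      fix i assume "i \<in> J"
      then show "(\<Sum>l\<le>k. real (k choose l) * (expectation (\<lambda>\<omega>. X i \<omega> ^ Suc l) * E (J - {i}) (k - l)))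
        = (\<Sum>l<k. real (k choose Suc l) *
            (expectation (\<lambda>\<omega>. X i \<omega> ^ (l + 2)) * E (J - {i}) (k - Suc l)))"
        unfolding sum.atMost_shift using mean1[of i] less.prems(1)
        by (simp only: subset_iff numeral_2_eq_2 add_Suc_right add_0_right mult_zero_left mult_zero_right add_0_left)
    qed
    have "\<bar>E J m\<bar> \<le> (\<Sum>i\<in>J. \<Sum>l<k. ?t l * R ^ (k - 1))"
      unfolding eq
    proof (intro order.trans[OF sum_abs] sum_mono)
      fix i l assume i: "i \<in> J" and l: "l \<in> {..<k}"
      have c: "card (J - {i}) \<le> card J" by (simp add: card_Diff1_le)
      then show "\<bar>real (k choose Suc l) *
          (expectation (\<lambda>\<omega>. X i \<omega> ^ (l + 2)) * E (J - {i}) (k - Suc l))\<bar> \<le> ?t l * R ^ (k - 1)"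
        using less.prems l i Suc by (intro term_bound less.IH) auto
    qed
    also have "\<dots> = real (card J) * (moment_bound A m * R ^ (k - 1))"
      by (simp only: Suc moment_bound.simps sum_distrib_right sum_constant of_nat_id)
    also have "\<dots> \<le> R\<^sup>2 * (moment_bound A m * R ^ (k - 1))"
      using less.prems A_nonneg moment_bound_nonneg[of A]
      by (intro mult_right_mono mult_nonneg_nonneg) auto
    also have "\<dots> = moment_bound A m * R ^ m"
    proof (cases k)
      \<comment> \<open>Here the truncated \<open>k - 1\<close> does not give the right power of
        \<open>R\<close>, but \<open>moment_bound A 1\<close> is an empty sum and both sides
        vanish.\<close>
      case 0
      then show ?thesis by (simp add: Suc)
    next
      case (Suc j)
      then have "R\<^sup>2 * R ^ (k - 1) = R ^ m"
        using \<open>m = Suc k\<close> by (simp only: power_add[symmetric]) simp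
      then show ?thesis by (metis mult.left_commute)
    qed
    finally show ?thesis .
  qed
qed

text \<open>In \<open>E_Suc\<close> the linear term vanishes and the quadratic one gives the
  variance times the \<open>m\<close>-th moment of the sum without \<open>X i\<close>. Restoring
  \<open>X i\<close> there, and dropping the cubic and higher terms, costs order
  \<open>R ^ (m - 1)\<close> for each of at most \<open>R ^ 2\<close> indices: one power of
  \<open>R\<close> less than the main term can have.\<close>

lemma E_recursion:
  assumes card_I: "real (card I) \<le> R\<^sup>2" and R: "1 \<le> R"
  shows "\<bar>E I (m + 2) - real (Suc m) * (\<Sum>i\<in>I. expectation (\<lambda>\<omega>. X i \<omega> ^ 2)) * E I m\<bar>
    \<le> recursion_bound A m * R ^ (m + 1)"
proof -
  let ?J = "\<lambda>i. I - {i}" and ?v = "\<lambda>i. expectation (\<lambda>\<omega>. X i \<omega> ^ 2)"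
  let ?a = "\<lambda>i. \<Sum>l<m. real (Suc m choose (l + 2)) *
      (expectation (\<lambda>\<omega>. X i \<omega> ^ (l + 3)) * E (?J i) (m - Suc l))"
  let ?b = "\<lambda>i. \<Sum>l<m. real (m choose Suc l) *
      (expectation (\<lambda>\<omega>. X i \<omega> ^ Suc l) * E (?J i) (m - Suc l))"
  let ?ca = "\<Sum>l<m. real (Suc m choose (l + 2)) * A (l + 3) * moment_bound A (m - Suc l)"
  let ?cb = "\<Sum>l<m. real (m choose Suc l) * A (Suc l) * moment_bound A (m - Suc l)"
  have bound: "\<bar>E (?J i) k\<bar> \<le> moment_bound A k * R ^ k" for i k
  proof -
    have "card (?J i) \<le> card I" by (simp add: card_Diff1_le)
    then show ?thesis using card_I R by (intro E_bound) auto
  qed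
  have "E I (m + 2) = E I (Suc (Suc m))" by simp
  also have "\<dots> = (\<Sum>i\<in>I. real (Suc m) * (?v i * E (?J i) m) + ?a i)"
    unfolding E_Suc[OF subset_refl]
  proof (rule sum.cong[OF refl])
    fix i assume "i \<in> I"
    then show "(\<Sum>l\<le>Suc m. real (Suc m choose l) *
        (expectation (\<lambda>\<omega>. X i \<omega> ^ Suc l) * E (?J i) (Suc m - l)))
      = real (Suc m) * (?v i * E (?J i) m) + ?a i"
      unfolding sum_atMost_Suc_shift2 using mean1[of i]
      by (simp only: numeral_2_eq_2 numeral_3_eq_3 One_nat_def add_Suc_right add_0_right diff_Suc_Suc
          diff_zero binomial_n_0 choose_one[unfolded One_nat_def] mult_zero_left mult_zero_right add_0_left)
  qed
  finally have "E I (m + 2) = (\<Sum>i\<in>I. real (Suc m) * (?v i * E (?J i) m) + ?a i)" .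
  moreover have diff: "E I m = E (?J i) m + ?b i" if "i \<in> I" for i
  proof -
    have "insert i (?J i) = I" using that by auto
    then have "E I m = (\<Sum>l\<le>m. real (m choose l) *
        (expectation (\<lambda>\<omega>. X i \<omega> ^ l) * E (?J i) (m - l)))"
      using expectation_insert[of "?J i" i 0 m] that by simp
    then show ?thesis by (simp add: sum.atMost_shift prob_space)
  qed
  ultimately have eq0: "E I (m + 2) - real (Suc m) * (\<Sum>i\<in>I. ?v i) * E I m
      = (\<Sum>i\<in>I. real (Suc m) * (?v i * E (?J i) m) + ?a i) - (\<Sum>i\<in>I. real (Suc m) * (?v i * (E (?J i) m + ?b i)))"
    by (simp add: sum_distrib_left sum_distrib_right mult.assoc)
  have eq: "E I (m + 2) - real (Suc m) * (\<Sum>i\<in>I. ?v i) * E I m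
      = (\<Sum>i\<in>I. ?a i - real (Suc m) * ?v i * ?b i)"
    unfolding eq0
    unfolding sum_subtractf[symmetric] by (intro sum.cong) (auto simp: algebra_simps)
  have "\<bar>E I (m + 2) - real (Suc m) * (\<Sum>i\<in>I. ?v i) * E I m\<bar>
      \<le> (\<Sum>i\<in>I. recursion_bound A m * R ^ (m - 1))"
    unfolding eq
  proof (intro order.trans[OF sum_abs] sum_mono)
    fix i assume i: "i \<in> I"
    have a: "\<bar>?a i\<bar> \<le> ?ca * R ^ (m - 1)"
      unfolding sum_distrib_right using i R bound
      by (intro order.trans[OF sum_abs] sum_mono term_bound) auto
    have b: "\<bar>?b i\<bar> \<le> ?cb * R ^ (m - 1)"
      unfolding sum_distrib_right using i R bound
      by (intro order.trans[OF sum_abs] sum_mono term_bound) auto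
    have "\<bar>?v i\<bar> * \<bar>?b i\<bar> \<le> A 2 * (?cb * R ^ (m - 1))"
      using b moments[OF i, of 2] A_nonneg by (intro mult_mono) auto
    then have "\<bar>real (Suc m) * ?v i * ?b i\<bar> \<le> real (Suc m) * (A 2 * (?cb * R ^ (m - 1)))"
      by (simp only: abs_mult mult.assoc abs_of_nat) (intro mult_left_mono, auto)
    moreover have "recursion_bound A m * R ^ (m - 1) =
        ?ca * R ^ (m - 1) + real (Suc m) * (A 2 * (?cb * R ^ (m - 1)))"
      unfolding recursion_bound_def by (simp only: distrib_right mult.assoc)
    ultimately show "\<bar>?a i - real (Suc m) * ?v i * ?b i\<bar> \<le> recursion_bound A m * R ^ (m - 1)"
      using a by linarith
  qed
  also have "\<dots> = real (card I) * (recursion_bound A m * R ^ (m - 1))" by simp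
  also have "\<dots> \<le> R\<^sup>2 * (recursion_bound A m * R ^ (m - 1))"
    using card_I R recursion_bound_nonneg[of A] A_nonneg by (intro mult_right_mono mult_nonneg_nonneg) auto
  also have "\<dots> = recursion_bound A m * R ^ (m + 1)"
  proof (cases m)
    case 0
    then show ?thesis by (simp add: recursion_bound_def)
  next
    case (Suc j)
    then have "R\<^sup>2 * R ^ (m - 1) = R ^ (m + 1)" by (simp only: power_add[symmetric]) simp
    then show ?thesis by (metis mult.left_commute)
  qed
  finally show ?thesis .
qed

end

section \<open>Circulant eigenvalues\<close>

text \<open>The symmetric circulant of size \<open>2 * n - 1\<close> has first row b_0, b_1, ...,
  b_{n-1}, b_{n-1}, ..., b_1. Every b_j with j > 0 occurs at the positions j and -j modulo the size,
  and the two conjugate roots of unity add up to twice a cosine; b_0 occurs only once.\<close>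

definition circulant_coeff :: "nat \<Rightarrow> nat \<Rightarrow> nat \<Rightarrow> real" where
  "circulant_coeff n k j = (if j = 0 then 1 else 2 * cos (2 * pi * real k * real j / real (2 * n - 1)))"

definition circulant_eigenvalue :: "nat \<Rightarrow> (nat \<Rightarrow> real) \<Rightarrow> nat \<Rightarrow> real" where
  "circulant_eigenvalue n b k = (\<Sum>j<n. circulant_coeff n k j * b j)"

definition unit_root :: "nat \<Rightarrow> int \<Rightarrow> complex" where
  "unit_root m t = cis (2 * pi * of_int t / real m)"

lemma unit_root_0 [simp]: "unit_root m 0 = 1"
  by (simp add: unit_root_def)

lemma unit_root_add: "unit_root m (s + t) = unit_root m s * unit_root m t"
  by (simp add: unit_root_def cis_mult ring_distribs add_divide_distrib)

lemma norm_unit_root [simp]: "norm (unit_root m t) = 1"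
  by (simp add: unit_root_def)

lemma unit_root_power: "unit_root m (int k * t) = unit_root m t ^ k"
  by (induction k) (simp_all add: ring_distribs unit_root_add)

lemma unit_root_eq_1_iff:
  assumes "0 < m"
  shows "unit_root m t = 1 \<longleftrightarrow> int m dvd t"
proof -
  have "unit_root m t = 1 \<longleftrightarrow> (\<exists>i::int. 2 * pi * of_int t / real m = 2 * pi * of_int i)"
    unfolding unit_root_def cis_conv_exp exp_eq_1 by auto
  also have "\<dots> \<longleftrightarrow> (\<exists>i::int. (of_int t :: real) = of_int (int m * i))"
    using assms by (auto simp: field_simps)
  also have "\<dots> \<longleftrightarrow> int m dvd t"
    unfolding of_int_eq_iff by (auto simp: dvd_def)
  finally show ?thesis .
qed

lemma sum_unit_root:
  assumes "0 < m"
  shows "(\<Sum>k<m. unit_root m (int k * t)) = (if int m dvd t then of_nat m else 0)"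
proof (cases "int m dvd t")
  case True
  then have "unit_root m (int k * t) = 1" for k by (simp add: unit_root_eq_1_iff[OF assms])
  then show ?thesis using True by simp
next
  case False
  have "unit_root m t ^ m = 1"
    unfolding unit_root_power[symmetric] using assms by (simp add: unit_root_eq_1_iff)
  then show ?thesis
    using False assms unit_root_eq_1_iff[of m t]
    by (simp add: unit_root_power sum_gp_strict)
qed

lemma sum_lessThan_add:
  fixes f :: "nat \<Rightarrow> 'a :: comm_monoid_add"
  shows "(\<Sum>j<p + q. f j) = (\<Sum>j<p. f j) + (\<Sum>j<q. f (p + j))"
  by (induction q) (simp_all add: add.assoc)

lemma circulant_coeff_unit_root:
  assumes "0 < n" "0 < j"
  shows "complex_of_real (circulant_coeff n k j) =
    unit_root (2 * n - 1) (int k * int j) + unit_root (2 * n - 1) (- (int k * int j))"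
  using assms by (simp add: circulant_coeff_def unit_root_def complex_eq_iff algebra_simps)

lemma abs_circulant_coeff_le: "\<bar>circulant_coeff n k j\<bar> \<le> 2"
  by (simp add: circulant_coeff_def abs_mult)

text \<open>The square of w^(kj) + w^(-kj) is 2 + w^(2kj) + w^(-2kj). The constants 2 add up to
  \<open>2 * n - 2\<close>; the rest, with the coefficient 1 at \<open>j = 0\<close> as the term of
  exponent 0, is a full sum of roots of unity of frequency 2k. It vanishes unless the odd number
  \<open>2 * n - 1\<close> divides 2k.\<close>

lemma sum_circulant_coeff_square:
  assumes n: "0 < n" and k: "k < 2 * n - 1"
  shows "(\<Sum>j<n. (circulant_coeff n k j)\<^sup>2) = real (2 * n - 2) + (if k = 0 then real (2 * n - 1) else 0)"
proof -
  let ?M = "2 * n - 1" and ?w = "unit_root (2 * n - 1)"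
  obtain p where p: "n = Suc p" using n by (cases n) auto
  have M: "0 < ?M" using n by simp
  have sq: "complex_of_real ((circulant_coeff n k (Suc j))\<^sup>2) = 2 + (?w (int (Suc j) * (2 * int k)) + ?w (- int (Suc j) * (2 * int k)))" for j
  proof -
    have "?w (int k * int (Suc j)) * ?w (- (int k * int (Suc j))) = 1"
      unfolding unit_root_add[symmetric] by simp
    then show ?thesis
      unfolding of_real_power circulant_coeff_unit_root[OF n zero_less_Suc] power2_sum
      by (simp add: power2_eq_square unit_root_add[symmetric] algebra_simps)
  qed
  \<comment> \<open>Modulo \<open>2 * p + 1\<close> the residues of -1, ..., -p are 2p, ..., p + 1,
    exactly those missing from 0, ..., p.\<close>
  have reflect: "(\<Sum>j<p. ?w (- int (Suc j) * (2 * int k))) = (\<Sum>j<p. ?w (int (p + Suc j) * (2 * int k)))"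
  proof (rule sum.reindex_bij_witness[of _ "\<lambda>j. p - Suc j" "\<lambda>j. p - Suc j"])
    fix j assume j: "j \<in> {..<p}"
    have "int (p + Suc (p - Suc j)) * (2 * int k) = - int (Suc j) * (2 * int k) + int (2 * k) * int ?M"
      using j p by (simp add: algebra_simps of_nat_diff)
    moreover have "?w (int (2 * k) * int ?M) = 1" using M by (simp add: unit_root_eq_1_iff)
    ultimately show "?w (int (p + Suc (p - Suc j)) * (2 * int k)) = ?w (- int (Suc j) * (2 * int k))"
      by (simp only: unit_root_add mult_1_right)
  qed auto
  have "complex_of_real (\<Sum>j<n. (circulant_coeff n k j)\<^sup>2)
      = 1 + (\<Sum>j<p. 2 + (?w (int (Suc j) * (2 * int k)) + ?w (- int (Suc j) * (2 * int k))))"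
    unfolding p sum.lessThan_Suc_shift of_real_add of_real_sum
    using sq unfolding p by (simp add: circulant_coeff_def)
  also have "\<dots> = of_nat (2 * p) + (1 + ((\<Sum>j<p. ?w (int (Suc j) * (2 * int k))) + (\<Sum>j<p. ?w (int (p + Suc j) * (2 * int k)))))"
    unfolding sum.distrib reflect by simp
  also have "1 + ((\<Sum>j<p. ?w (int (Suc j) * (2 * int k))) + (\<Sum>j<p. ?w (int (p + Suc j) * (2 * int k))))
      = (\<Sum>j<Suc (p + p). ?w (int j * (2 * int k)))"
    unfolding sum.lessThan_Suc_shift sum_lessThan_add by simp
  also have "Suc (p + p) = ?M" using p by simp
  also have "(\<Sum>j<?M. ?w (int j * (2 * int k))) = (if int ?M dvd 2 * int k then of_nat ?M else 0)"
    by (rule sum_unit_root[OF M])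
  also have "int ?M dvd 2 * int k \<longleftrightarrow> k = 0"
  proof
    assume "int ?M dvd 2 * int k"
    moreover have "coprime (int ?M) 2" using n by (simp add: of_nat_diff coprime_commute)
    ultimately have "int ?M dvd int k" by (simp add: coprime_dvd_mult_right_iff)
    then have "?M dvd k" by (simp only: int_dvd_int_iff)
    then show "k = 0" using k nat_dvd_not_less by blast
  qed simp
  finally have "complex_of_real (\<Sum>j<n. (circulant_coeff n k j)\<^sup>2) =
      complex_of_real (real (2 * n - 2) + (if k = 0 then real (2 * n - 1) else 0))"
    using p by simp
  then show ?thesis unfolding of_real_eq_iff .
qed

lemma dvd_iff_abs_lt_twice:
  fixes m t :: int
  assumes "\<bar>t\<bar> < 2 * m"
  shows "m dvd t \<longleftrightarrow> t = 0 \<or> \<bar>t\<bar> = m"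
proof
  assume "m dvd t"
  then obtain q where q: "t = m * q" by blast
  have "0 < m" using assms by linarith
  then have "m * \<bar>q\<bar> < m * 2" using q assms by (simp add: abs_mult)
  then have "\<bar>q\<bar> < 2" using \<open>0 < m\<close> by (simp only: mult_less_cancel_left_pos)
  then have "q = 0 \<or> q = 1 \<or> q = -1" by arith
  then show "t = 0 \<or> \<bar>t\<bar> = m" using q \<open>0 < m\<close> by auto
qed auto

locale palindrome =
  fixes n :: nat and b :: "nat \<Rightarrow> real"
  assumes n_pos: "0 < n"
begin

definition M :: nat where "M = 2 * n - 1"

abbreviation eig :: "nat \<Rightarrow> real" where "eig \<equiv> circulant_eigenvalue n b"

text \<open>
  \<open>K l\<close> is the generating function of the \<open>l\<close>-th power of the circulant matrix of size \<open>M\<close>,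
  and \<open>K 1\<close> also describes all entries of the palindromic matrix, whose last row and column
  repeat the first ones. Hence products of kernels over \<open>2 * n\<close> indices only differ from
  convolutions by one extra term.
\<close>
definition K :: "nat \<Rightarrow> int \<Rightarrow> complex" where
  "K l d = (\<Sum>k<M. of_real (eig k) ^ l * unit_root M (int k * d)) / of_nat M"

lemma M_pos: "0 < M" and Suc_M: "Suc M = 2 * n"
  using n_pos by (simp_all add: M_def)

lemma K_periodic: "int M dvd d - d' \<Longrightarrow> K l d = K l d'"
proof -
  assume "int M dvd d - d'"
  then have 1: "unit_root M (int k * (d - d')) = 1" for k
    using unit_root_eq_1_iff[OF M_pos] by simp
  have "unit_root M (int k * d) = unit_root M (int k * d')" for k
  proof -
    have "int k * d = int k * (d - d') + int k * d'" by (simp add: algebra_simps)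
    then show ?thesis using 1[of k] by (simp only: unit_root_add mult_1_left)
  qed
  then show ?thesis by (simp add: K_def)
qed

lemma K_zero: "K l 0 = of_real ((\<Sum>k<M. eig k ^ l) / real M)"
  by (simp add: K_def)

lemma norm_K_le:
  assumes "\<And>k. k < M \<Longrightarrow> \<bar>eig k\<bar> \<le> s"
  shows "norm (K l d) \<le> s ^ l"
proof -
  have "norm (\<Sum>k<M. of_real (eig k) ^ l * unit_root M (int k * d)) \<le> (\<Sum>k<M. s ^ l)"
    using assms by (intro sum_norm_le) (simp add: norm_mult norm_power power_mono)
  then show ?thesis
    using M_pos by (simp add: K_def norm_divide divide_le_eq mult.commute)
qed

text \<open>Powers of a circulant multiply by cyclic convolution: orthogonality of the characters
  modulo \<open>M\<close> leaves only the diagonal of the double sum over eigenvalues.\<close>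

lemma K_convolution: "(\<Sum>y<M. K i (x - int y) * K j (int y - z)) = K (i + j) (x - z)"
proof -
  let ?w = "unit_root M" and ?c = "\<lambda>k. complex_of_real (eig k)"
  have orth: "(\<Sum>y<M. ?w (int y * (int l - int k))) = (if l = k then of_nat M else 0)"
    if "k < M" "l < M" for k l
  proof -
    have "int M dvd int l - int k \<longleftrightarrow> l = k"
      using that dvd_iff_abs_lt_twice[of "int l - int k" "int M"] by auto
    then show ?thesis using sum_unit_root[OF M_pos, of "int l - int k"] by simp
  qed
  have split: "?w (int k * (x - int y)) * ?w (int l * (int y - z)) =
      ?w (int k * x - int l * z) * ?w (int y * (int l - int k))" for k l y
    unfolding unit_root_add[symmetric] by (simp add: algebra_simps)
  have "(\<Sum>y<M. K i (x - int y) * K j (int y - z)) =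
      (\<Sum>y<M. \<Sum>k<M. \<Sum>l<M. ?c k ^ i * ?c l ^ j *
        (?w (int k * (x - int y)) * ?w (int l * (int y - z)))) / (of_nat M)\<^sup>2"
    unfolding K_def times_divide_times_eq sum_product power2_eq_square sum_divide_distrib[symmetric]
    by (simp only: mult_ac)
  also have "(\<Sum>y<M. \<Sum>k<M. \<Sum>l<M. ?c k ^ i * ?c l ^ j *
        (?w (int k * (x - int y)) * ?w (int l * (int y - z)))) =
      (\<Sum>k<M. \<Sum>l<M. ?c k ^ i * ?c l ^ j * ?w (int k * x - int l * z) *
        (\<Sum>y<M. ?w (int y * (int l - int k))))"
    unfolding split sum_distrib_left
    by (subst sum.swap, rule sum.cong[OF refl], subst sum.swap) (simp only: mult.assoc)
  also have "\<dots> = (\<Sum>k<M. \<Sum>l<M. if l = k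
      then ?c k ^ i * ?c l ^ j * ?w (int k * x - int l * z) * of_nat M else 0)"
    using orth by (intro sum.cong refl) (auto)
  also have "\<dots> = (\<Sum>k<M. ?c k ^ (i + j) * ?w (int k * (x - z)) * of_nat M)"
    by (intro sum.cong refl) (simp add: power_add right_diff_distrib)
  also have "\<dots> / (of_nat M)\<^sup>2 = K (i + j) (x - z)"
    unfolding K_def sum_distrib_right[symmetric] using M_pos by (simp add: power2_eq_square)
  finally show ?thesis .
qed

lemma K_convolution_extra:
  "(\<Sum>y<2 * n. K i (x - int y) * K j (int y - z)) = K (i + j) (x - z) + K i x * K j (- z)"
proof -
  have "K i (x - int M) = K i x" "K j (int M - z) = K j (- z)"
    by (auto intro!: K_periodic)
  then show ?thesis using K_convolution[of i x j z] by (simp only: Suc_M[symmetric] sum.lessThan_Suc)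
qed

text \<open>Fourier inversion modulo \<open>M\<close>: the sum over \<open>k\<close> picks out the
  \<open>j\<close> congruent to \<open>d\<close> or \<open>- d\<close>. The extreme case of
  \<open>d\<close> with absolute value \<open>M\<close> belongs to the two corners of the
  palindromic matrix, whose entry b_0 agrees with periodicity.\<close>

lemma K_1:
  assumes "\<bar>d\<bar> \<le> int M"
  shows "K 1 d = of_real (b (nat (min \<bar>d\<bar> (int M - \<bar>d\<bar>))))"
proof -
  let ?w = "unit_root M"
  define e where "e = nat (min \<bar>d\<bar> (int M - \<bar>d\<bar>))"
  have e: "e < n" using assms Suc_M unfolding e_def by linarith
  have coeff: "(\<Sum>k<M. of_real (circulant_coeff n k j) * ?w (int k * d)) =
      (if j = e then of_nat M else 0)" if j: "j < n" for j
  proof (cases "j = 0")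
    case True
    have "int M dvd d \<longleftrightarrow> e = 0"
    proof -
      have "int M dvd d \<longleftrightarrow> d = 0 \<or> \<bar>d\<bar> = int M"
        using assms M_pos by (intro dvd_iff_abs_lt_twice) auto
      then show ?thesis using assms unfolding e_def by linarith
    qed
    then show ?thesis using True sum_unit_root[OF M_pos, of d]
      by (auto simp: circulant_coeff_def)
  next
    case False
    have M: "int M = 2 * int n - 1" using Suc_M by linarith
    have "(\<Sum>k<M. of_real (circulant_coeff n k j) * ?w (int k * d)) =
        (\<Sum>k<M. ?w (int k * (d + int j))) + (\<Sum>k<M. ?w (int k * (d - int j)))"
      unfolding sum.distrib[symmetric]
    proof (rule sum.cong[OF refl])
      fix k
      show "of_real (circulant_coeff n k j) * ?w (int k * d) =
          ?w (int k * (d + int j)) + ?w (int k * (d - int j))"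
        using False n_pos unfolding M_def
        by (simp add: circulant_coeff_unit_root distrib_right unit_root_add[symmetric] algebra_simps)
    qed
    also have "\<dots> = (if int M dvd d + int j then of_nat M else 0) + (if int M dvd d - int j then of_nat M else 0)"
      by (simp only: sum_unit_root[OF M_pos])
    also have "\<dots> = (if j = e then of_nat M else 0)"
    proof -
      have *: "\<bar>d + int j\<bar> < 2 * int M" "\<bar>d - int j\<bar> < 2 * int M" using assms j False M by linarith+
      have **: "int e = min \<bar>d\<bar> (int M - \<bar>d\<bar>)" using assms by (simp add: e_def)
      have a1: "(d + int j = 0 \<or> \<bar>d + int j\<bar> = int M) \<or> (d - int j = 0 \<or> \<bar>d - int j\<bar> = int M) \<longleftrightarrow> int j = int e"
        unfolding ** using assms j False M by (auto simp: min_def abs_if split: if_splits)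
      \<comment> \<open>Both signs at once would make \<open>M\<close> divide \<open>2 * j\<close>,
        while \<open>0 < 2 * j < M\<close>; so no entry is counted twice.\<close>
      have a2: "\<not> ((d + int j = 0 \<or> \<bar>d + int j\<bar> = int M) \<and> (d - int j = 0 \<or> \<bar>d - int j\<bar> = int M))"
        using assms j False M by (auto simp: abs_if split: if_splits)
      have gen: "(if p then c else 0) + (if q then c else 0) = (if r then c else 0)"
        if "p \<or> q \<longleftrightarrow> r" "\<not> (p \<and> q)" for p q r and c :: complex
        using that by auto
      show ?thesis
        unfolding dvd_iff_abs_lt_twice[OF *(1)] dvd_iff_abs_lt_twice[OF *(2)]
        by (rule gen[OF a1[unfolded of_nat_eq_iff] a2])
    qed
    finally show ?thesis .
  qed
  have "(\<Sum>k<M. of_real (eig k) * ?w (int k * d)) =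
      (\<Sum>j<n. of_real (b j) * (\<Sum>k<M. of_real (circulant_coeff n k j) * ?w (int k * d)))"
    unfolding circulant_eigenvalue_def of_real_sum sum_distrib_left sum_distrib_right
    by (subst sum.swap) (simp only: of_real_mult mult_ac)
  also have "\<dots> = (\<Sum>j<n. if j = e then of_real (b j) * of_nat M else 0)"
    using coeff by (intro sum.cong refl) (auto)
  also have "\<dots> = of_real (b e) * of_nat M" using e by simp
  finally show ?thesis using M_pos unfolding e_def[symmetric] by (simp add: K_def)
qed

end

section \<open>Comparison of the matrix trace with the circulant power sum\<close>

context palindrome
begin

definition A :: "real mat" where "A = palindromic_toeplitz (2 * n) b"

definition P :: "nat \<Rightarrow> nat \<Rightarrow> nat \<Rightarrow> complex" where
  "P i x y = of_real ((A ^\<^sub>m i) $$ (x, y))"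

text \<open>
  Moving factors from \<open>P\<close> to \<open>K\<close> one at a time, \<open>T i j\<close> interpolates between the trace of a power
  of the palindromic matrix and the power sum of the circulant eigenvalues; \<open>H\<close> collects the
  extra terms.
\<close>
definition T :: "nat \<Rightarrow> nat \<Rightarrow> complex" where
  "T i j = (\<Sum>x<2 * n. \<Sum>y<2 * n. P i x y * K j (int y - int x))"

definition H :: "nat \<Rightarrow> nat \<Rightarrow> nat \<Rightarrow> complex" where
  "H i j l = (\<Sum>x<2 * n. \<Sum>y<2 * n. K j (- int x) * P i x y * K l (int y))"

lemma A_carrier: "A \<in> carrier_mat (2 * n) (2 * n)"
  unfolding A_def by (rule palindromic_toeplitz_carrier)

lemma A_entry:
  assumes "x < 2 * n" "y < 2 * n"
  shows "of_real (A $$ (x, y)) = K 1 (int x - int y)"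
proof -
  define d where "d = nat \<bar>int x - int y\<bar>"
  have d: "\<bar>int x - int y\<bar> = int d" by (simp add: d_def)
  have "int d < int (2 * n)" using assms unfolding d[symmetric] abs_less_iff by simp
  then have "d \<le> M" unfolding Suc_M[symmetric] of_nat_less_iff by simp
  moreover from this have "nat (min (int d) (int M - int d)) = min d (M - d)"
    by (simp flip: of_nat_diff of_nat_min)
  moreover have "A $$ (x, y) = b (min d (M - d))"
    using assms unfolding A_def palindromic_toeplitz_def M_def d_def by (simp only: index_mat Let_def split_conv)
  ultimately show ?thesis using K_1[of "int x - int y"] d by (simp only: of_nat_le_iff)
qed

lemma P_0:
  assumes "x < 2 * n" "y < 2 * n"
  shows "P 0 x y = (if x = y then 1 else 0)"
  using assms A_carrier by (auto simp: P_def)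

lemma P_Suc:
  assumes "x < 2 * n" "z < 2 * n"
  shows "P (Suc i) x z = (\<Sum>y<2 * n. P i x y * K 1 (int y - int z))"
proof -
  have "A ^\<^sub>m i \<in> carrier_mat (2 * n) (2 * n)" using A_carrier by (rule pow_carrier_mat)
  then have "(A ^\<^sub>m Suc i) $$ (x, z) = (\<Sum>y<2 * n. (A ^\<^sub>m i) $$ (x, y) * A $$ (y, z))"
    using assms A_carrier by (auto simp: scalar_prod_def lessThan_atLeast0 intro!: sum.cong)
  then have "P (Suc i) x z = (\<Sum>y<2 * n. P i x y * of_real (A $$ (y, z)))"
    by (simp add: P_def del: pow_mat.simps)
  also have "\<dots> = (\<Sum>y<2 * n. P i x y * K 1 (int y - int z))"
    using assms(2) by (intro sum.cong refl) (simp only: A_entry lessThan_iff)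
  finally show ?thesis .
qed

text \<open>The last matrix factor is absorbed into the kernel by associativity. The free integer
  \<open>z\<close> lets the same identity serve \<open>T\<close>, with \<open>z\<close> the row
  index, and \<open>H\<close>, with \<open>z = 0\<close>.\<close>

lemma P_Suc_K:
  assumes "x < 2 * n"
  shows "(\<Sum>y<2 * n. P (Suc i) x y * K j (int y - z)) =
    (\<Sum>u<2 * n. P i x u * (K (Suc j) (int u - z) + K 1 (int u) * K j (- z)))"
proof -
  have "(\<Sum>y<2 * n. P (Suc i) x y * K j (int y - z)) =
      (\<Sum>y<2 * n. \<Sum>u<2 * n. P i x u * (K 1 (int u - int y) * K j (int y - z)))"
    by (rule sum.cong[OF refl]) (simp add: assms P_Suc sum_distrib_right mult.assoc)
  also have "\<dots> = (\<Sum>u<2 * n. P i x u * (\<Sum>y<2 * n. K 1 (int u - int y) * K j (int y - z)))"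
    by (subst sum.swap) (simp only: sum_distrib_left)
  also have "\<dots> = (\<Sum>u<2 * n. P i x u * (K (Suc j) (int u - z) + K 1 (int u) * K j (- z)))"
    by (simp add: K_convolution_extra)
  finally show ?thesis .
qed

lemma T_Suc: "T (Suc i) j = T i (Suc j) + H i j 1"
proof -
  have "T (Suc i) j = (\<Sum>x<2 * n. \<Sum>u<2 * n. P i x u *
      (K (Suc j) (int u - int x) + K 1 (int u) * K j (- int x)))"
    unfolding T_def by (rule sum.cong[OF refl]) (simp only: P_Suc_K lessThan_iff)
  then show ?thesis
    unfolding T_def H_def by (simp add: distrib_left sum.distrib mult_ac)
qed

lemma H_Suc: "H (Suc i) j l = H i j (Suc l) + H i j 1 * K l 0"
proof -
  have "H (Suc i) j l = (\<Sum>x<2 * n. K j (- int x) * (\<Sum>y<2 * n. P (Suc i) x y * K l (int y - 0)))"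
    unfolding H_def by (simp add: sum_distrib_left mult.assoc)
  also have "\<dots> = (\<Sum>x<2 * n. K j (- int x) *
      (\<Sum>u<2 * n. P i x u * (K (Suc l) (int u - 0) + K 1 (int u) * K l (- 0))))"
    by (rule sum.cong[OF refl]) (simp only: P_Suc_K lessThan_iff)
  also have "\<dots> = H i j (Suc l) + H i j 1 * K l 0"
    unfolding H_def
    by (simp add: distrib_left sum.distrib sum_distrib_left sum_distrib_right mult.assoc)
  finally show ?thesis .
qed

lemma T_0: "T 0 j = of_nat (2 * n) * K j 0"
proof -
  have "T 0 j = (\<Sum>x<2 * n. \<Sum>y<2 * n. if x = y then K j 0 else 0)"
    unfolding T_def by (intro sum.cong[of "{..<2 * n}", OF refl]) (simp add: P_0)
  then show ?thesis by simp
qed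

lemma H_0: "H 0 j l = K (j + l) 0 + K j 0 * K l 0"
proof -
  have "H 0 j l = (\<Sum>x<2 * n. K j (0 - int x) * K l (int x - 0))"
  proof -
    have "H 0 j l = (\<Sum>x<2 * n. \<Sum>y<2 * n. if x = y then K j (0 - int x) * K l (int x - 0) else 0)"
      unfolding H_def by (intro sum.cong[of "{..<2 * n}", OF refl]) (simp add: P_0)
    then show ?thesis by simp
  qed
  then show ?thesis by (simp only: K_convolution_extra) simp
qed

lemma trace_power: "of_real (mat_trace (A ^\<^sub>m Suc i)) = T i 1"
proof -
  have "dim_row (A ^\<^sub>m Suc i) = 2 * n" using pow_carrier_mat[OF A_carrier, of "Suc i"] by blast
  then have "complex_of_real (mat_trace (A ^\<^sub>m Suc i)) = (\<Sum>x<2 * n. P (Suc i) x x)"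
    by (simp add: mat_trace_def P_def del: pow_mat.simps)
  also have "\<dots> = T i 1"
    unfolding T_def by (rule sum.cong[OF refl]) (simp only: P_Suc lessThan_iff)
  finally show ?thesis .
qed

text \<open>Each use of \<open>H_Suc\<close> gives two terms of unchanged total degree, whence the
  power of 2. The sums over \<open>2 * n\<close> indices are evaluated by convolution instead of
  being estimated termwise, so no factor \<open>n\<close> is lost.\<close>

lemma norm_H_le:
  assumes s: "\<And>k. k < M \<Longrightarrow> \<bar>eig k\<bar> \<le> s"
  shows "norm (H i j l) \<le> 2 ^ Suc i * s ^ (i + j + l)"
proof (induction i arbitrary: j l)
  case 0
  have s0: "0 \<le> s" using s[OF M_pos] by linarith
  have "norm (H 0 j l) \<le> s ^ (j + l) + s ^ j * s ^ l"
    unfolding H_0 using norm_K_le[OF s] s0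
    by (intro norm_triangle_mono order.trans[OF norm_mult_ineq] mult_mono) auto
  then show ?case by (simp add: power_add)
next
  case (Suc i)
  have s0: "0 \<le> s" using s[OF M_pos] by linarith
  have "norm (H (Suc i) j l) \<le> 2 ^ Suc i * s ^ (i + j + Suc l) + (2 ^ Suc i * s ^ (i + j + 1)) * s ^ l"
    unfolding H_Suc using norm_K_le[OF s] s0
    by (intro norm_triangle_mono order.trans[OF norm_mult_ineq] mult_mono Suc) auto
  then show ?case by (simp add: power_add mult_ac)
qed

text \<open>Moving all \<open>i\<close> matrix factors into the kernel adds one error term per move,
  and the bounds of \<open>norm_H_le\<close> form a geometric sum.\<close>

lemma norm_T_le:
  assumes s: "\<And>k. k < M \<Longrightarrow> \<bar>eig k\<bar> \<le> s"
  shows "norm (T i j - of_nat (2 * n) * K (i + j) 0) \<le> 2 ^ Suc i * s ^ (i + j)"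
proof (induction i arbitrary: j)
  case 0
  have "0 \<le> s" using s[OF M_pos] by linarith
  then show ?case by (simp add: T_0)
next
  case (Suc i)
  have "T (Suc i) j - of_nat (2 * n) * K (Suc i + j) 0 =
      (T i (Suc j) - of_nat (2 * n) * K (i + Suc j) 0) + H i j 1"
    by (simp add: T_Suc)
  also have "norm \<dots> \<le> 2 ^ Suc i * s ^ (i + Suc j) + 2 ^ Suc i * s ^ (i + j + 1)"
    by (intro norm_triangle_mono Suc norm_H_le[OF s])
  finally show ?case by (simp add: mult_ac)
qed

lemma trace_power_approx:
  assumes s: "\<And>k. k < M \<Longrightarrow> \<bar>eig k\<bar> \<le> s" and m: "0 < m"
  shows "\<bar>mat_trace (A ^\<^sub>m m) - real (2 * n) / real M * (\<Sum>k<M. eig k ^ m)\<bar> \<le> 2 ^ m * s ^ m"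
proof -
  obtain i where i: "m = Suc i" using m gr0_implies_Suc by blast
  have "complex_of_real (mat_trace (A ^\<^sub>m m) - real (2 * n) / real M * (\<Sum>k<M. eig k ^ m)) =
      T i 1 - of_nat (2 * n) * K (i + 1) 0"
    unfolding i of_real_diff trace_power K_zero by simp
  then have "\<bar>mat_trace (A ^\<^sub>m m) - real (2 * n) / real M * (\<Sum>k<M. eig k ^ m)\<bar> =
      norm (T i 1 - of_nat (2 * n) * K (i + 1) 0)"
    by (metis norm_of_real)
  then show ?thesis using norm_T_le[OF s, of i 1] i by simp
qed

text \<open>
  The maximal eigenvalue is traded for a power sum of degree \<open>2 * m\<close>; the loss is harmless because
  \<open>t\<close> can be taken of order \<open>(2 n) powr ((m + 1) / 2)\<close>, which is smaller than the normalisation.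
\<close>
lemma trace_power_approx_moment:
  assumes m: "0 < m" and t: "0 < t"
  shows "\<bar>mat_trace (A ^\<^sub>m m) - real (2 * n) / real M * (\<Sum>k<M. eig k ^ m)\<bar>
    \<le> 2 ^ m * (t + (\<Sum>k<M. eig k ^ (2 * m)) / t)"
proof -
  define s where "s = Max ((\<lambda>k. \<bar>eig k\<bar>) ` {..<M})"
  have s: "\<bar>eig k\<bar> \<le> s" if "k < M" for k
    unfolding s_def using that by (intro Max_ge) auto
  have "s \<in> (\<lambda>k. \<bar>eig k\<bar>) ` {..<M}"
    unfolding s_def using M_pos by (intro Max_in) auto
  then obtain k where k: "k < M" "s = \<bar>eig k\<bar>" by auto
  have "(s ^ m)\<^sup>2 = eig k ^ (2 * m)"
    unfolding k(2) by (simp add: power_mult[symmetric] mult.commute[of m 2] power_even_abs)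
  also have "\<dots> \<le> (\<Sum>k<M. eig k ^ (2 * m))"
    using k(1) by (intro member_le_sum) auto
  finally have sq: "(s ^ m)\<^sup>2 \<le> (\<Sum>k<M. eig k ^ (2 * m))" .
  have "0 \<le> s" using s[OF M_pos] by linarith
  then have "0 \<le> s ^ m * t" using t by simp
  moreover have "2 * (s ^ m * t) \<le> (s ^ m)\<^sup>2 + t\<^sup>2"
    using sum_squares_bound[of "s ^ m" t] by (simp only: mult.assoc)
  ultimately have "s ^ m * t \<le> t\<^sup>2 + (s ^ m)\<^sup>2" by linarith
  then have "s ^ m \<le> t + (s ^ m)\<^sup>2 / t"
    using t by (simp add: field_simps power2_eq_square)
  also have "\<dots> \<le> t + (\<Sum>k<M. eig k ^ (2 * m)) / t"
    using sq t by (simp add: divide_right_mono)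
  finally have "2 ^ m * s ^ m \<le> 2 ^ m * (t + (\<Sum>k<M. eig k ^ (2 * m)) / t)"
    by (intro mult_left_mono) auto
  with trace_power_approx[OF s m] show ?thesis by (rule order.trans)
qed

end

section \<open>The random matrix\<close>

lemma palindromic_toeplitz_trace_approx:
  assumes "0 < n" "0 < m" "0 < t"
  shows "\<bar>mat_trace (palindromic_toeplitz (2 * n) b ^\<^sub>m m) -
      real (2 * n) / real (2 * n - 1) * (\<Sum>k<2 * n - 1. circulant_eigenvalue n b k ^ m)\<bar>
    \<le> 2 ^ m * (t + (\<Sum>k<2 * n - 1. circulant_eigenvalue n b k ^ (2 * m)) / t)"
proof -
  interpret palindrome n b using assms(1) by unfold_locales
  show ?thesis using trace_power_approx_moment[OF assms(2,3)] unfolding A_def M_def .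
qed

locale random_palindrome = prob_space \<Omega> for \<Omega> :: "'w measure" +
  fixes n :: nat and b :: "nat \<Rightarrow> 'w \<Rightarrow> real" and a :: "nat \<Rightarrow> real"
  assumes n_pos: "0 < n"
    and indep_b: "indep_vars (\<lambda>_. borel) b {..<n}"
    and int_b: "\<And>i k. i < n \<Longrightarrow> integrable \<Omega> (\<lambda>\<omega>. b i \<omega> ^ k)"
    and mean_b: "\<And>i. i < n \<Longrightarrow> expectation (b i) = 0"
    and variance_b: "\<And>i. i < n \<Longrightarrow> expectation (\<lambda>\<omega>. b i \<omega> ^ 2) = 1"
    and moments_b: "\<And>i k. i < n \<Longrightarrow> \<bar>expectation (\<lambda>\<omega>. b i \<omega> ^ k)\<bar> \<le> a k"
    and a_nonneg: "\<And>k. 0 \<le> a k"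
begin

definition eig :: "nat \<Rightarrow> 'w \<Rightarrow> real" where
  "eig k \<omega> = circulant_eigenvalue n (\<lambda>i. b i \<omega>) k"

definition e :: "nat \<Rightarrow> nat \<Rightarrow> real" where
  "e k m = expectation (\<lambda>\<omega>. eig k \<omega> ^ m)"

definition r :: real where "r = sqrt (real (2 * n))"

text \<open>The \<open>m\<close>-th moment of a circulant eigenvalue, averaged over \<open>k\<close>
  and scaled by \<open>r\<close>. The scale comes from the full size \<open>2 * n\<close> while the
  variance is \<open>2 * n - 2\<close>, so the recursion carries a ratio that only tends to
  1.\<close>

definition Q :: "nat \<Rightarrow> real" where
  "Q m = (\<Sum>k<2 * n - 1. e k m) / (real (2 * n - 1) * r ^ m)"

abbreviation tr :: "nat \<Rightarrow> 'w \<Rightarrow> real" where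
  "tr m \<omega> \<equiv> mat_trace (palindromic_toeplitz (2 * n) (\<lambda>i. b i \<omega>) ^\<^sub>m m)"

abbreviation B :: "nat \<Rightarrow> real" where "B \<equiv> moment_bound (\<lambda>k. 2 ^ k * a k)"

abbreviation D :: "nat \<Rightarrow> real" where "D \<equiv> recursion_bound (\<lambda>k. 2 ^ k * a k)"

text \<open>The weights are at most 2 in absolute value, so the bounds \<open>2 ^ k * a k\<close>
  hold for all eigenvalues at once.\<close>

lemma centred_indep_eigenvalue:
  "centred_indep \<Omega> (\<lambda>j \<omega>. circulant_coeff n k j * b j \<omega>) {..<n} (\<lambda>k. 2 ^ k * a k)"
proof
  show "indep_vars (\<lambda>_. borel) (\<lambda>j \<omega>. circulant_coeff n k j * b j \<omega>) {..<n}"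
    by (rule indep_vars_compose2[OF indep_b]) auto
next
  fix j l assume j: "j \<in> {..<n}"
  have eq: "expectation (\<lambda>\<omega>. (circulant_coeff n k j * b j \<omega>) ^ l) =
      circulant_coeff n k j ^ l * expectation (\<lambda>\<omega>. b j \<omega> ^ l)"
    by (simp add: power_mult_distrib)
  have "\<bar>circulant_coeff n k j ^ l\<bar> \<le> 2 ^ l"
    unfolding power_abs by (intro power_mono abs_circulant_coeff_le) auto
  then show "\<bar>expectation (\<lambda>\<omega>. (circulant_coeff n k j * b j \<omega>) ^ l)\<bar> \<le> 2 ^ l * a l"
    unfolding eq abs_mult using moments_b j by (intro mult_mono) auto
qed (use int_b mean_b a_nonneg in \<open>auto simp: power_mult_distrib\<close>)

lemma card_bound: "real (card {..<n}) \<le> (sqrt (real n))\<^sup>2" "1 \<le> sqrt (real n)"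
  using n_pos by auto

lemma r_pos: "0 < r" and r_square: "r\<^sup>2 = real (2 * n)" and sqrt_le_r: "sqrt (real n) \<le> r"
  using n_pos by (auto simp: r_def)

lemma integrable_eig: "integrable \<Omega> (\<lambda>\<omega>. eig k \<omega> ^ m)"
  using centred_indep.integrable_S_power[OF centred_indep_eigenvalue subset_refl]
  unfolding eig_def circulant_eigenvalue_def .

lemma e_bound: "\<bar>e k m\<bar> \<le> B m * r ^ m"
proof -
  have "\<bar>e k m\<bar> \<le> B m * sqrt (real n) ^ m"
    using centred_indep.E_bound[OF centred_indep_eigenvalue subset_refl card_bound]
    unfolding e_def eig_def circulant_eigenvalue_def .
  also have "\<dots> \<le> B m * r ^ m"
    using sqrt_le_r a_nonneg by (intro mult_left_mono power_mono moment_bound_nonneg) auto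
  finally show ?thesis .
qed

lemma e_0: "e k 0 = 1"
  by (simp add: e_def prob_space)

lemma e_1: "e k 1 = 0"
  \<comment> \<open>\<open>B 1\<close> is an empty sum.\<close>
  using e_bound[of k 1] by simp

lemma e_recursion:
  assumes "k < 2 * n - 1"
  shows "\<bar>e k (m + 2) - real (Suc m) * (real (2 * n - 2) + (if k = 0 then real (2 * n - 1) else 0)) * e k m\<bar>
    \<le> D m * r ^ (m + 1)"
proof -
  have "(\<Sum>j<n. expectation (\<lambda>\<omega>. (circulant_coeff n k j * b j \<omega>) ^ 2)) = (\<Sum>j<n. (circulant_coeff n k j)\<^sup>2)"
    using variance_b by (intro sum.cong refl) (simp add: power_mult_distrib)
  also have "\<dots> = real (2 * n - 2) + (if k = 0 then real (2 * n - 1) else 0)"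
    by (rule sum_circulant_coeff_square[OF n_pos assms])
  finally have V: "(\<Sum>j<n. expectation (\<lambda>\<omega>. (circulant_coeff n k j * b j \<omega>) ^ 2)) = \<dots>" .
  have "\<bar>e k (m + 2) - real (Suc m) * (real (2 * n - 2) + (if k = 0 then real (2 * n - 1) else 0)) * e k m\<bar>
      \<le> D m * sqrt (real n) ^ (m + 1)"
    using centred_indep.E_recursion[OF centred_indep_eigenvalue[of k] card_bound, of m]
    unfolding V unfolding e_def eig_def circulant_eigenvalue_def .
  also have "\<dots> \<le> D m * r ^ (m + 1)"
    using sqrt_le_r a_nonneg by (intro mult_left_mono power_mono recursion_bound_nonneg) auto
  finally show ?thesis .
qed

lemma Q_0: "Q 0 = 1"
  using n_pos by (simp add: Q_def e_0)

lemma Q_1: "Q 1 = 0"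
  by (simp add: Q_def e_1 del: One_nat_def)

text \<open>The first error term comes from \<open>e_recursion\<close>. The second is the excess
  variance \<open>2 * n - 1\<close> of the eigenvalue with \<open>k = 0\<close>, which cancels
  against its weight in the average and leaves a quotient by \<open>2 * n\<close>.\<close>

lemma Q_recursion:
  "\<bar>Q (m + 2) - real (Suc m) * (real (2 * n - 2) / real (2 * n)) * Q m\<bar>
    \<le> D m / r + real (Suc m) * B m / real (2 * n)"
proof -
  let ?M = "2 * n - 1" and ?c = "real (Suc m) * real (2 * n - 2)"
  have M: "0 < real ?M" using n_pos by simp
  have rr: "r ^ (m + 2) = r ^ m * real (2 * n)" by (simp only: power_add r_square)
  have alg: "x / (u * (v * w)) - s * (t / w) * (y / (u * v)) = (x - s * t * y) / (u * (v * w))"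
    if "u \<noteq> 0" "v \<noteq> 0" "w \<noteq> 0" for s t u v w x y :: real
    using that by (simp add: field_simps)
  have eq: "Q (m + 2) - real (Suc m) * (real (2 * n - 2) / real (2 * n)) * Q m =
      (\<Sum>k<?M. e k (m + 2) - ?c * e k m) / (real ?M * r ^ (m + 2))"
    unfolding Q_def sum_subtractf sum_distrib_left[symmetric] rr
    using M r_pos n_pos by (intro alg) auto
  have bound: "\<bar>\<Sum>k<?M. e k (m + 2) - ?c * e k m\<bar>
      \<le> real ?M * (D m * r ^ (m + 1)) + real ?M * (real (Suc m) * B m * r ^ m)"
  proof -
    have "\<bar>\<Sum>k<?M. e k (m + 2) - ?c * e k m\<bar>
        \<le> (\<Sum>k<?M. D m * r ^ (m + 1) + (if k = 0 then real ?M * (real (Suc m) * B m * r ^ m) else 0))"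
    proof (intro order.trans[OF sum_abs] sum_mono)
      fix k assume "k \<in> {..<?M}"
      then have k: "k < ?M" by simp
      show "\<bar>e k (m + 2) - ?c * e k m\<bar>
          \<le> D m * r ^ (m + 1) + (if k = 0 then real ?M * (real (Suc m) * B m * r ^ m) else 0)"
      proof (cases "k = 0")
        case True
        have "real (Suc m) * real ?M * \<bar>e k m\<bar> \<le> real (Suc m) * real ?M * (B m * r ^ m)"
          by (intro mult_left_mono e_bound) auto
        then have err: "\<bar>real (Suc m) * real ?M * e k m\<bar> \<le> real ?M * (real (Suc m) * B m * r ^ m)"
          by (simp only: abs_mult abs_of_nat mult_ac)
        have rec: "\<bar>e k (m + 2) - real (Suc m) * (real (2 * n - 2) + real ?M) * e k m\<bar> \<le> D m * r ^ (m + 1)"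
          using e_recursion[OF k, of m] True by (simp only: simp_thms if_True)
        have "e k (m + 2) - ?c * e k m =
            (e k (m + 2) - real (Suc m) * (real (2 * n - 2) + real ?M) * e k m) + real (Suc m) * real ?M * e k m"
          by (simp only: ring_distribs)
        then have "\<bar>e k (m + 2) - ?c * e k m\<bar> \<le> D m * r ^ (m + 1) + real ?M * (real (Suc m) * B m * r ^ m)"
          using order.trans[OF abs_triangle_ineq add_mono[OF rec err]] by (simp only:)
        then show ?thesis using True by (simp only: simp_thms if_True)
      next
        case False
        then show ?thesis using e_recursion[OF k, of m] by simp
      qed
    qed
    also have "\<dots> = real ?M * (D m * r ^ (m + 1)) + real ?M * (real (Suc m) * B m * r ^ m)"
      unfolding sum.distrib using n_pos by simp
    finally show ?thesis .
  qed
  have rhs: "(real ?M * (D m * r ^ (m + 1)) + real ?M * (real (Suc m) * B m * r ^ m)) / (real ?M * r ^ (m + 2))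
      = D m / r + real (Suc m) * B m / real (2 * n)"
  proof -
    have "D m * r ^ (m + 1) / r ^ (m + 2) = D m / r"
      using r_pos by (simp add: field_simps)
    moreover have "real (Suc m) * B m * r ^ m / r ^ (m + 2) = real (Suc m) * B m / real (2 * n)"
      unfolding power_add r_square using r_pos by simp
    moreover have "real ?M * x / (real ?M * y) = x / y" for x y
      using M by (intro nonzero_mult_divide_mult_cancel_left) simp
    ultimately show ?thesis
      unfolding distrib_left[symmetric] by (simp only: add_divide_distrib)
  qed
  have abs_div: "\<bar>x / y\<bar> \<le> z / y" if "\<bar>x\<bar> \<le> z" "0 < y" for x y z :: real
    using that by (simp add: abs_divide divide_right_mono)
  have "0 < real ?M * r ^ (m + 2)"
    using M r_pos by (intro mult_pos_pos zero_less_power)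
  from abs_div[OF bound this] show ?thesis unfolding eq rhs .
qed

text \<open>Measurability is read off from the trace, a polynomial in the entries, rather than from
  the eigenvalues.\<close>

lemma tr_measurable: "tr m \<in> borel_measurable \<Omega>"
proof -
  let ?A = "\<lambda>\<omega>. palindromic_toeplitz (2 * n) (\<lambda>i. b i \<omega>)"
  have b: "b i \<in> borel_measurable \<Omega>" if "i < n" for i
    using indep_b that by (auto simp: indep_vars_def2)
  have entry: "(\<lambda>\<omega>. ?A \<omega> $$ (x, y)) \<in> borel_measurable \<Omega>" if "x < 2 * n" "y < 2 * n" for x y
  proof -
    define d where "d = nat \<bar>int x - int y\<bar>"
    have "min d (2 * n - 1 - d) < n" using n_pos by linarith
    then show ?thesis
      using that b by (simp add: palindromic_toeplitz_def Let_def d_def[symmetric])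
  qed
  have pow: "?A \<omega> ^\<^sub>m i \<in> carrier_mat (2 * n) (2 * n)" for i \<omega>
    by (rule pow_carrier_mat[OF palindromic_toeplitz_carrier])
  have meas: "\<forall>x<2 * n. \<forall>y<2 * n. (\<lambda>\<omega>. (?A \<omega> ^\<^sub>m i) $$ (x, y)) \<in> borel_measurable \<Omega>" for i
  proof (induction i)
    case 0
    have "dim_row (?A \<omega>) = 2 * n" for \<omega> by (simp add: palindromic_toeplitz_def)
    then show ?case by simp
  next
    case (Suc i)
    have "(?A \<omega> ^\<^sub>m Suc i) $$ (x, y) = (\<Sum>z<2 * n. (?A \<omega> ^\<^sub>m i) $$ (x, z) * ?A \<omega> $$ (z, y))"
      if "x < 2 * n" "y < 2 * n" for x y \<omega>
      using that pow[of \<omega> i] palindromic_toeplitz_carrier[of "2 * n" "\<lambda>i. b i \<omega>"]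
      by (auto simp: scalar_prod_def lessThan_atLeast0 intro!: sum.cong)
    then show ?case using Suc entry
      by (auto simp del: pow_mat.simps intro!: borel_measurable_sum borel_measurable_times)
  qed
  have "dim_row (?A \<omega> ^\<^sub>m m) = 2 * n" for \<omega>
    by (rule carrier_matD(1)[OF pow])
  then have eq: "tr m = (\<lambda>\<omega>. \<Sum>x<2 * n. (?A \<omega> ^\<^sub>m m) $$ (x, x))"
    unfolding mat_trace_def by simp
  show ?thesis
    unfolding eq using meas[of m] by (intro borel_measurable_sum) simp
qed

lemma tr_0: "tr 0 \<omega> = real (2 * n)"
  using palindromic_toeplitz_carrier[of "2 * n" "\<lambda>i. b i \<omega>"] by (simp add: mat_trace_def)

text \<open>The trace differs from an integrable power sum by a quantity dominated through the trace
  comparison with \<open>t = 1\<close>.\<close>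

lemma integrable_tr: "integrable \<Omega> (tr m)"
proof (cases "m = 0")
  case True
  then show ?thesis by (simp add: tr_0 del: pow_mat.simps)
next
  case False
  let ?c = "\<lambda>\<omega>. real (2 * n) / real (2 * n - 1) * (\<Sum>k<2 * n - 1. eig k \<omega> ^ m)"
  let ?d = "\<lambda>\<omega>. 2 ^ m * (1 + (\<Sum>k<2 * n - 1. eig k \<omega> ^ (2 * m)) / 1)"
  have c: "integrable \<Omega> ?c" using integrable_eig by simp
  have "integrable \<Omega> (\<lambda>\<omega>. tr m \<omega> - ?c \<omega>)"
  proof (rule Bochner_Integration.integrable_bound)
    show "integrable \<Omega> ?d" using integrable_eig by simp
    show "AE \<omega> in \<Omega>. norm (tr m \<omega> - ?c \<omega>) \<le> norm (?d \<omega>)"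
    proof (rule AE_I2)
      fix \<omega>
      have "\<bar>tr m \<omega> - ?c \<omega>\<bar> \<le> ?d \<omega>"
        using False palindromic_toeplitz_trace_approx[OF n_pos, of m 1] unfolding eig_def by simp
      then show "norm (tr m \<omega> - ?c \<omega>) \<le> norm (?d \<omega>)" unfolding real_norm_def by (rule order.trans[OF _ abs_ge_self])
    qed
  qed (use tr_measurable c in measurable)
  from Bochner_Integration.integrable_add[OF this c] show ?thesis by simp
qed

lemma expectation_tr:
  assumes "0 < m"
  shows "\<bar>expectation (tr m) / (r ^ m * real (2 * n)) - Q m\<bar> \<le> 2 ^ m * (1 + B (2 * m)) / r"
proof -
  \<comment> \<open>This choice balances the two error terms: the power sum of degree
    \<open>2 * m\<close> has expectation of order \<open>r ^ (2 * m + 2)\<close>, the square of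
    \<open>?t\<close>. Against the normalisation \<open>r ^ (m + 2)\<close> a factor
    \<open>1 / r\<close> is gained.\<close>
  let ?M = "2 * n - 1" and ?t = "r ^ (m + 1)"
  let ?c = "\<lambda>\<omega>. real (2 * n) / real ?M * (\<Sum>k<?M. eig k \<omega> ^ m)"
  let ?d = "\<lambda>\<omega>. 2 ^ m * (?t + (\<Sum>k<?M. eig k \<omega> ^ (2 * m)) / ?t)"
  have M: "0 < real ?M" using n_pos by simp
  have t: "0 < ?t" using r_pos by simp
  have c: "integrable \<Omega> ?c" and d: "integrable \<Omega> ?d" using integrable_eig by simp_all
  have "\<bar>expectation (tr m) - expectation ?c\<bar> = \<bar>expectation (\<lambda>\<omega>. tr m \<omega> - ?c \<omega>)\<bar>"
    using integrable_tr c by (subst Bochner_Integration.integral_diff) auto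
  also have "\<dots> \<le> expectation (\<lambda>\<omega>. \<bar>tr m \<omega> - ?c \<omega>\<bar>)"
    by (rule integral_abs_bound)
  also have "\<dots> \<le> expectation ?d"
    using palindromic_toeplitz_trace_approx[OF n_pos assms t] integrable_tr c d unfolding eig_def
    by (intro integral_mono) auto
  also have "\<dots> = 2 ^ m * (?t + (\<Sum>k<?M. e k (2 * m)) / ?t)"
    unfolding e_def using integrable_eig prob_space by simp
  also have "\<dots> \<le> 2 ^ m * (?t + (r\<^sup>2 * (B (2 * m) * r ^ (2 * m))) / ?t)"
  proof -
    have "(\<Sum>k<?M. e k (2 * m)) \<le> (\<Sum>k<?M. B (2 * m) * r ^ (2 * m))"
      using e_bound by (intro sum_mono) (meson abs_le_D1)
    also have "\<dots> = real ?M * (B (2 * m) * r ^ (2 * m))" by simp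
    also have "\<dots> \<le> r\<^sup>2 * (B (2 * m) * r ^ (2 * m))"
      unfolding r_square using r_pos a_nonneg
      by (intro mult_right_mono mult_nonneg_nonneg moment_bound_nonneg) auto
    finally show ?thesis using t by (intro mult_left_mono add_left_mono divide_right_mono) auto
  qed
  also have "(r\<^sup>2 * (B (2 * m) * r ^ (2 * m))) / ?t = B (2 * m) * ?t"
  proof -
    have eq: "r\<^sup>2 * r ^ (2 * m) = ?t * ?t"
      unfolding power_add[symmetric] by (rule arg_cong[of _ _ "power r"]) simp
    have "r\<^sup>2 * (B (2 * m) * r ^ (2 * m)) = B (2 * m) * (r\<^sup>2 * r ^ (2 * m))"
      by (rule mult.left_commute)
    also have "\<dots> = B (2 * m) * ?t * ?t" unfolding eq by (rule mult.assoc[symmetric])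
    finally have "r\<^sup>2 * (B (2 * m) * r ^ (2 * m)) = B (2 * m) * ?t * ?t" .
    then show ?thesis using t by (simp only: nonzero_mult_div_cancel_right less_imp_neq[symmetric] not_False_eq_True)
  qed
  finally have bound: "\<bar>expectation (tr m) - expectation ?c\<bar> \<le> 2 ^ m * (?t + B (2 * m) * ?t)" .
  have "expectation ?c = real (2 * n) / real ?M * (\<Sum>k<?M. e k m)"
    unfolding e_def using integrable_eig by simp
  moreover have "x / (u * v) - y / (w * u) = (x - v / w * y) / (u * v)"
    if "u \<noteq> 0" "v \<noteq> 0" "w \<noteq> 0" for u v w x y :: real
    using that by (simp add: field_simps)
  ultimately have eq: "expectation (tr m) / (r ^ m * real (2 * n)) - Q m =
      (expectation (tr m) - expectation ?c) / (r ^ m * real (2 * n))"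
    unfolding Q_def using n_pos M r_pos by simp
  have "\<bar>expectation (tr m) / (r ^ m * real (2 * n)) - Q m\<bar> =
      \<bar>expectation (tr m) - expectation ?c\<bar> / (r ^ m * r\<^sup>2)"
    unfolding eq r_square abs_divide using r_pos by (simp add: abs_mult)
  also have "\<dots> \<le> 2 ^ m * (?t + B (2 * m) * ?t) / (r ^ m * r\<^sup>2)"
    using r_pos by (intro divide_right_mono[OF bound]) simp
  also have "\<dots> = 2 ^ m * (1 + B (2 * m)) / r"
    using r_pos by (simp add: field_simps power2_eq_square)
  finally show ?thesis .
qed

lemma spectral_moment_tr:
  "spectral_moment m (palindromic_toeplitz (2 * n) (\<lambda>i. b i \<omega>)) = tr m \<omega> / (r ^ m * real (2 * n))"
proof -
  have "real (2 * n) powr (real m / 2 + 1) = r ^ m * real (2 * n)"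
    using n_pos by (simp add: r_def powr_add powr_half_sqrt[symmetric] powr_realpow[symmetric] powr_powr)
  then show ?thesis
    using n_pos spectral_moment_eq[OF palindromic_toeplitz_carrier palindromic_toeplitz_symmetric, of "2 * n" m]
      sum_proots_power_eq_trace[OF palindromic_toeplitz_carrier palindromic_toeplitz_symmetric]
    by simp
qed

lemma integrable_spectral_moment:
  "integrable \<Omega> (\<lambda>\<omega>. spectral_moment m (palindromic_toeplitz (2 * n) (\<lambda>i. b i \<omega>)))"
  unfolding spectral_moment_tr using integrable_tr by simp

lemma average_moment_approx:
  "\<bar>average_moment m (2 * n) \<Omega> b - Q m\<bar> \<le> 2 ^ m * (1 + B (2 * m)) / r"
proof (cases "m = 0")
  case True
  have "0 \<le> B (2 * m)" using a_nonneg by (intro moment_bound_nonneg) auto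
  then show ?thesis
    using True n_pos r_pos Q_0 prob_space
    by (simp add: average_moment_def spectral_moment_tr tr_0 del: pow_mat.simps)
next
  case False
  then show ?thesis
    using expectation_tr[of m] by (simp add: average_moment_def spectral_moment_tr)
qed

end

section \<open>Transfer from the law \<open>p\<close>, Gaussian moments and the limit\<close>

lemma random_palindromeI:
  assumes p_moments: "\<And>k. integrable p (\<lambda>x. x ^ k)"
    and p_mean: "prob_space.expectation p (\<lambda>x. x) = 0"
    and p_variance: "prob_space.variance p (\<lambda>x. x) = 1"
    and prob: "prob_space \<Omega>"
    and indep: "prob_space.indep_vars \<Omega> (\<lambda>_. borel) b {..<n}"
    and ident: "\<And>i. i < n \<Longrightarrow> distr \<Omega> borel (b i) = p"
    and n: "0 < n"
  shows "random_palindrome \<Omega> n b (\<lambda>k. \<bar>prob_space.expectation p (\<lambda>x. x ^ k)\<bar>)"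
proof -
  interpret prob_space \<Omega> by (rule prob)
  have meas: "b i \<in> borel_measurable \<Omega>" if "i < n" for i
    using indep that by (auto simp: indep_vars_def2)
  have ex: "expectation (\<lambda>\<omega>. b i \<omega> ^ k) = integral\<^sup>L p (\<lambda>x. x ^ k)" if "i < n" for i k
    using integral_distr[OF meas[OF that], of "\<lambda>x. x ^ k"] ident[OF that] by simp
  show ?thesis
  proof
    fix i k assume i: "i < n"
    show "integrable \<Omega> (\<lambda>\<omega>. b i \<omega> ^ k)"
      using integrable_distr_eq[OF meas[OF i], of "\<lambda>x. x ^ k"] ident[OF i] p_moments by simp
    show "\<bar>expectation (\<lambda>\<omega>. b i \<omega> ^ k)\<bar> \<le> \<bar>integral\<^sup>L p (\<lambda>x. x ^ k)\<bar>"
      using ex[OF i] by simp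
    show "expectation (b i) = 0" using ex[OF i, of 1] p_mean by simp
    show "expectation (\<lambda>\<omega>. b i \<omega> ^ 2) = 1" using ex[OF i, of 2] p_mean p_variance by simp
  qed (use n indep in auto)
qed

text \<open>The limiting form of \<open>Q_recursion\<close>. With the moments of order 0 and 1 it
  determines the Gaussian moments, so the limits can be identified by induction.\<close>

lemma std_normal_moment_recursion:
  "(\<integral>x. std_normal_density x * x ^ (m + 2) \<partial>lborel) =
    real (Suc m) * (\<integral>x. std_normal_density x * x ^ m \<partial>lborel)"
proof (cases "even m")
  case True
  then obtain k where k: "m = 2 * k" by blast
  have "(\<integral>x. std_normal_density x * x ^ (m + 2) \<partial>lborel) = fact (2 * Suc k) / (2 ^ Suc k * fact (Suc k))"
    using integral_std_normal_moment_even[of "Suc k"] by (simp add: k)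
  also have "\<dots> = real (Suc m) * (fact (2 * k) / (2 ^ k * fact k))"
  proof -
    have "(fact (2 * Suc k) :: real) = 2 * real (Suc k) * (real (Suc m) * fact (2 * k))"
      by (simp add: k algebra_simps)
    moreover have "2 * c * (s * f) / (2 * u * (c * v)) = s * (f / (u * v))"
      if "c \<noteq> 0" for c s f u v :: real
      using that by simp
    ultimately show ?thesis
      by (simp only: power_Suc fact_Suc of_nat_eq_0_iff nat.distinct not_False_eq_True)
  qed
  finally show ?thesis by (simp only: k integral_std_normal_moment_even)
next
  case False
  then obtain k where k: "m = 2 * k + 1" by (blast elim: oddE)
  show ?thesis
    using integral_std_normal_moment_odd[of k] integral_std_normal_moment_odd[of "Suc k"]
    by (simp add: k)
qed

lemma std_normal_moment_even_double_fact:
  "(\<integral>x. std_normal_density x * x ^ (2 * k) \<partial>lborel) = (\<Prod>i=1..k. 2 * real i - 1)"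
proof (induction k)
  case 0
  then show ?case using integral_std_normal_moment_even[of 0] by simp
next
  case (Suc k)
  then show ?case using std_normal_moment_recursion[of "2 * k"] by (simp add: algebra_simps)
qed

theorem theorem2p1:
  fixes p :: "real measure"
    and \<Omega> :: "nat \<Rightarrow> 'w measure"
    and b :: "nat \<Rightarrow> nat \<Rightarrow> 'w \<Rightarrow> real"
  assumes p_law: "real_distribution p"
    and p_moments: "\<And>k. integrable p (\<lambda>x. x ^ k)"
    and p_mean: "prob_space.expectation p (\<lambda>x. x) = 0"
    and p_variance: "prob_space.variance p (\<lambda>x. x) = 1"
    and prob: "\<And>N. even N \<Longrightarrow> 0 < N \<Longrightarrow> prob_space (\<Omega> N)"
    and indep: "\<And>N. even N \<Longrightarrow> 0 < N \<Longrightarrow>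
      prob_space.indep_vars (\<Omega> N) (\<lambda>_. borel) (b N) {..<N div 2}"
    and ident: "\<And>N i. even N \<Longrightarrow> 0 < N \<Longrightarrow> i < N div 2 \<Longrightarrow> distr (\<Omega> N) borel (b N i) = p"
  shows "(\<forall>m N. even N \<longrightarrow> 0 < N \<longrightarrow>
            integrable (\<Omega> N) (\<lambda>\<omega>. spectral_moment m (palindromic_toeplitz N (\<lambda>i. b N i \<omega>))))
       \<and> (\<forall>m. (\<lambda>n. average_moment m (2 * n) (\<Omega> (2 * n)) (b (2 * n))) 
              \<longlonglongrightarrow> (\<integral>x. std_normal_density x * x ^ m \<partial>lborel))
       \<and> (\<forall>k. (\<lambda>n. average_moment (2 * k + 1) (2 * n) (\<Omega> (2 * n)) (b (2 * n))) \<longlonglongrightarrow> 0)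
       \<and> (\<forall>k. (\<lambda>n. average_moment (2 * k) (2 * n) (\<Omega> (2 * n)) (b (2 * n))) 
              \<longlonglongrightarrow> (\<Prod>i=1..k. 2 * real i - 1))"
proof -
  define a where "a = (\<lambda>k. \<bar>prob_space.expectation p (\<lambda>x. x ^ k)\<bar>)"
  define g where "g = (\<lambda>m. \<integral>x. std_normal_density x * x ^ m \<partial>lborel)"
  define q where "q = (\<lambda>n. random_palindrome.Q (\<Omega> (2 * n)) n (b (2 * n)))"
  define B where "B = moment_bound (\<lambda>k. 2 ^ k * a k)"
  define D where "D = recursion_bound (\<lambda>k. 2 ^ k * a k)"
  let ?avg = "\<lambda>m n. average_moment m (2 * n) (\<Omega> (2 * n)) (b (2 * n))"
  have R: "random_palindrome (\<Omega> (2 * n)) n (b (2 * n)) a" if "0 < n" for n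
    unfolding a_def using that prob[of "2 * n"] indep[of "2 * n"] ident[of "2 * n"]
    by (intro random_palindromeI p_moments p_mean p_variance) auto
  have q_lim: "(\<lambda>n. q n m) \<longlonglongrightarrow> g m" for m
  proof (induction m rule: less_induct)
    case (less m)
    consider "m = 0" | "m = 1" | i where "m = i + 2"
      by (metis One_nat_def add_2_eq_Suc' not0_implies_Suc)
    then show ?case
    proof cases
      case 1
      have "g 0 = 1" using integral_std_normal_moment_even[of 0] by (simp add: g_def)
      \<comment> \<open>No probability space is assumed for \<open>n = 0\<close>, so the identities
        and bounds are used only eventually.\<close>
      moreover have "\<forall>\<^sub>F n in sequentially. q n 0 = 1"
        using eventually_gt_at_top[of 0] by eventually_elim (simp add: q_def random_palindrome.Q_0[OF R])
      ultimately show ?thesis using 1 by (simp add: tendsto_eventually)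
    next
      case 2
      have "g 1 = 0" using integral_std_normal_moment_odd[of 0] by (simp add: g_def)
      moreover have "\<forall>\<^sub>F n in sequentially. q n 1 = 0"
        using eventually_gt_at_top[of 0] by eventually_elim (simp only: q_def random_palindrome.Q_1[OF R])
      ultimately show ?thesis using 2 by (simp add: tendsto_eventually)
    next
      case 3
      let ?c = "\<lambda>n. real (Suc i) * (real (2 * n - 2) / real (2 * n)) * q n i"
      have "(\<lambda>n. real (2 * n - 2) / real (2 * n)) \<longlonglongrightarrow> 1" by real_asymp
      then have c: "?c \<longlonglongrightarrow> real (Suc i) * 1 * g i"
        using less[of i] 3 by (intro tendsto_intros) auto
      have "(\<lambda>n. q n m - ?c n) \<longlonglongrightarrow> 0"
      proof (rule Lim_null_comparison)
        show "\<forall>\<^sub>F n in sequentially. norm (q n m - ?c n) \<le>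
            D i / sqrt (real (2 * n)) + real (Suc i) * B i / real (2 * n)"
          using eventually_gt_at_top[of 0]
        proof eventually_elim
          case (elim n)
          interpret random_palindrome "\<Omega> (2 * n)" n "b (2 * n)" a by (rule R[OF elim])
          show ?case
            using Q_recursion[of i] unfolding 3 q_def B_def D_def r_def real_norm_def .
        qed
        show "(\<lambda>n. D i / sqrt (real (2 * n)) + real (Suc i) * B i / real (2 * n)) \<longlonglongrightarrow> 0"
          by real_asymp
      qed
      from tendsto_add[OF this c] show ?thesis
        using std_normal_moment_recursion[of i] by (simp add: 3 g_def)
    qed
  qed
  have avg: "?avg m \<longlonglongrightarrow> g m" for m
  proof -
    have "(\<lambda>n. ?avg m n - q n m) \<longlonglongrightarrow> 0"
    proof (rule Lim_null_comparison)
      show "\<forall>\<^sub>F n in sequentially. norm (?avg m n - q n m) \<le> 2 ^ m * (1 + B (2 * m)) / sqrt (real (2 * n))"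
        using eventually_gt_at_top[of 0]
      proof eventually_elim
        case (elim n)
        interpret random_palindrome "\<Omega> (2 * n)" n "b (2 * n)" a by (rule R[OF elim])
        show ?case
          using average_moment_approx[of m] unfolding q_def B_def r_def real_norm_def .
      qed
      show "(\<lambda>n. 2 ^ m * (1 + B (2 * m)) / sqrt (real (2 * n))) \<longlonglongrightarrow> 0" by real_asymp
    qed
    from tendsto_add[OF this q_lim[of m]] show ?thesis by simp
  qed
  have "integrable (\<Omega> N) (\<lambda>\<omega>. spectral_moment m (palindromic_toeplitz N (\<lambda>i. b N i \<omega>)))"
    if "even N" "0 < N" for m N
  proof -
    from that obtain n where n: "N = 2 * n" "0 < n" by auto
    show ?thesis
      unfolding n(1) by (rule random_palindrome.integrable_spectral_moment[OF R[OF n(2)]])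
  qed
  moreover have "g (2 * k + 1) = 0" for k
    unfolding g_def by (rule integral_std_normal_moment_odd)
  moreover have "g (2 * k) = (\<Prod>i=1..k. 2 * real i - 1)" for k
    unfolding g_def by (rule std_normal_moment_even_double_fact)
  moreover note avg[of "2 * k + 1" for k] avg[of "2 * k" for k] avg
  ultimately show ?thesis
    unfolding g_def by simp
qed

end
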